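(* The quartics $X_{1/2}$, $X_{1/4}$, $X_{1/6}$, and $X_{7/10}$ are rational.
   Context: The base field $\Bbbk$ is algebraically closed of characteristic zero. For $t\in\Bbbk$ the quartic threefold $X_t$ is given in the hyperplane $\mathbb{P}^4=\{x_1+\dots+x_6=0\}\subset\mathbb{P}^5$ by $\sum_{i=1}^6x_i^4-t\big(\sum_{i=1}^6x_i^2\big)^2=0$. *)

theory Defs
  imports "HOL-Analysis.Analysis"
begin

section \<open>Projective space\<close>

definition proportional :: "'k::field ^ 'n \<Rightarrow> 'k ^ 'n \<Rightarrow> bool" where
  "proportional v w \<longleftrightarrow> v \<noteq> 0 \<and> (\<exists>c. c \<noteq> 0 \<and> w = c *s v)"

lemma proportional_refl: "v \<noteq> 0 \<Longrightarrow> proportional v v"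
  unfolding proportional_def by (metis one_neq_zero vector_smult_lid)

lemma part_equivp_proportional:
  "part_equivp (proportional :: 'k::field ^ 'n \<Rightarrow> 'k ^ 'n \<Rightarrow> bool)"
proof (rule part_equivpI)
  have "(vec 1 :: 'k ^ 'n) \<noteq> 0" by (simp add: vec_eq_iff)
  then show "\<exists>v. proportional v (v :: 'k ^ 'n)"
    using proportional_refl by blast
  show "symp (proportional :: 'k ^ 'n \<Rightarrow> 'k ^ 'n \<Rightarrow> bool)"
  proof (rule sympI)
    fix v w :: "'k ^ 'n"
    assume "proportional v w"
    then obtain c where c: "v \<noteq> 0" "c \<noteq> 0" "w = c *s v"
      unfolding proportional_def by blast
    then have "v = inverse c *s w" "w \<noteq> 0" "inverse c \<noteq> 0"
      by (auto simp: vector_smult_assoc)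
    then show "proportional w v" unfolding proportional_def by blast
  qed
  show "transp (proportional :: 'k ^ 'n \<Rightarrow> 'k ^ 'n \<Rightarrow> bool)"
    unfolding proportional_def transp_def
    by (metis mult_eq_0_iff vector_smult_assoc)
qed

text \<open>The type \<open>('k, 'n) proj\<close> is the projective space of dimension \<open>CARD('n) - 1\<close> over
  the field \<open>'k\<close>, with homogeneous coordinates indexed by \<open>'n\<close>.\<close>

quotient_type (overloaded) ('k, 'n) proj =
  "('k::field) ^ ('n::finite)" / partial: proportional
  morphisms rep_proj proj_point
  by (rule part_equivp_proportional)

text \<open>\<^const>\<open>proj_point\<close> \<open>v\<close> is the point with homogeneous coordinates \<open>v\<close>; it is only
  meaningful for \<open>v \<noteq> 0\<close>.\<close>

lemma proj_point_eq_iff: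
  assumes "v \<noteq> 0" "w \<noteq> 0"
  shows "proj_point v = proj_point w \<longleftrightarrow> (\<exists>c. c \<noteq> 0 \<and> w = c *s v)"
  using Quotient3_rel[OF Quotient3_proj, of v w] assms proportional_refl[of v] proportional_refl[of w]
  by (auto simp: proportional_def)

lemma proj_point_cases:
  obtains v where "v \<noteq> 0" "p = proj_point v"
  using Quotient3_abs_rep[OF Quotient3_proj, of p] Quotient3_rep_reflp[OF Quotient3_proj, of p]
  unfolding proportional_def by metis


section \<open>Homogeneous polynomials and the Zariski topology\<close>

text \<open>The ground field being infinite, a polynomial is identified with the function it
  induces. A monomial is given by its exponents \<open>a :: 'n \<Rightarrow> nat\<close>.\<close>

definition homogeneous_poly :: "nat \<Rightarrow> ('k::field ^ 'n \<Rightarrow> 'k) \<Rightarrow> bool" where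
  "homogeneous_poly d f \<longleftrightarrow>
    (\<exists>c :: ('n \<Rightarrow> nat) \<Rightarrow> 'k. \<forall>x.
      f x = (\<Sum>a | (\<Sum>i\<in>UNIV. a i) = d. c a * (\<Prod>i\<in>UNIV. (x $ i) ^ a i)))"

definition zero_locus :: "('k::field ^ 'n \<Rightarrow> 'k) set \<Rightarrow> ('k, 'n) proj set" where
  "zero_locus S = {proj_point v | v. v \<noteq> 0 \<and> (\<forall>f\<in>S. f v = 0)}"

definition zariski_closed :: "('k::field, 'n::finite) proj set \<Rightarrow> bool" where
  "zariski_closed Z \<longleftrightarrow> (\<exists>S. (\<forall>f\<in>S. \<exists>d. homogeneous_poly d f) \<and> Z = zero_locus S)"

definition zariski :: "('k::field, 'n::finite) proj topology" where
  "zariski = topology (\<lambda>U. zariski_closed (- U))"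

lemma finite_exponents: "finite {a :: 'n::finite \<Rightarrow> nat. (\<Sum>i\<in>UNIV. a i) = d}"
proof (rule finite_subset)
  show "{a. (\<Sum>i\<in>UNIV. a i) = d} \<subseteq> (UNIV :: 'n set) \<rightarrow>\<^sub>E {..d}"
    by (auto intro: member_le_sum)
  show "finite ((UNIV :: 'n set) \<rightarrow>\<^sub>E {..d})"
    by (intro finite_PiE) auto
qed

lemma homogeneous_poly_scale:
  assumes "homogeneous_poly d f"
  shows "f (c *s v) = c ^ d * f v"
proof -
  obtain k where k: "\<And>x. f x = (\<Sum>a | (\<Sum>i\<in>UNIV. a i) = d. k a * (\<Prod>i\<in>UNIV. (x $ i) ^ a i))"
    using assms unfolding homogeneous_poly_def by blast
  show ?thesis
    unfolding k sum_distrib_left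
    by (intro sum.cong refl) (auto simp: power_mult_distrib prod.distrib power_sum)
qed

lemma homogeneous_poly_mult:
  fixes f g :: "'k::field ^ 'n \<Rightarrow> 'k"
  assumes "homogeneous_poly d f" "homogeneous_poly e g"
  shows "homogeneous_poly (d + e) (\<lambda>x. f x * g x)"
proof -
  obtain k where k: "\<And>x. f x = (\<Sum>a | (\<Sum>i\<in>UNIV. a i) = d. k a * (\<Prod>i\<in>UNIV. (x $ i) ^ a i))"
    using assms(1) unfolding homogeneous_poly_def by blast
  obtain l where l: "\<And>x. g x = (\<Sum>a | (\<Sum>i\<in>UNIV. a i) = e. l a * (\<Prod>i\<in>UNIV. (x $ i) ^ a i))"
    using assms(2) unfolding homogeneous_poly_def by blast
  define A where "A = (\<lambda>d. {a :: 'n \<Rightarrow> nat. (\<Sum>i\<in>UNIV. a i) = d})"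
  define P where "P = A d \<times> A e"
  define s where "s = (\<lambda>(a :: 'n \<Rightarrow> nat, b :: 'n \<Rightarrow> nat). (\<lambda>i. a i + b i))"
  have fin: "finite (A n)" for n unfolding A_def by (rule finite_exponents)
  have sub: "s ` P \<subseteq> A (d + e)"
    by (auto simp: P_def s_def A_def sum.distrib)
  define c where "c = (\<lambda>m. \<Sum>q | q \<in> P \<and> s q = m. k (fst q) * l (snd q))"
  have "f x * g x = (\<Sum>m\<in>A (d + e). c m * (\<Prod>i\<in>UNIV. (x $ i) ^ m i))" for x
  proof -
    have "f x * g x = (\<Sum>q\<in>P. k (fst q) * l (snd q) * (\<Prod>i\<in>UNIV. (x $ i) ^ s q i))"
      unfolding k l P_def A_def sum_product sum.cartesian_product
      by (intro sum.cong refl) (auto simp: s_def power_add prod.distrib)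
    also have "\<dots> = (\<Sum>m\<in>A (d + e). \<Sum>q | q \<in> P \<and> s q = m.
        k (fst q) * l (snd q) * (\<Prod>i\<in>UNIV. (x $ i) ^ s q i))"
      by (rule sum.group[symmetric]) (use fin sub in \<open>auto simp: P_def\<close>)
    also have "\<dots> = (\<Sum>m\<in>A (d + e). c m * (\<Prod>i\<in>UNIV. (x $ i) ^ m i))"
      unfolding c_def sum_distrib_right by (intro sum.cong refl) auto
    finally show ?thesis .
  qed
  then show ?thesis unfolding homogeneous_poly_def A_def by blast
qed

lemma proj_point_in_zero_locus:
  assumes "\<forall>f\<in>S. \<exists>d. homogeneous_poly d f" "v \<noteq> 0"
  shows "proj_point v \<in> zero_locus S \<longleftrightarrow> (\<forall>f\<in>S. f v = 0)"
proof
  assume "proj_point v \<in> zero_locus S"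
  then obtain w where w: "w \<noteq> 0" "proj_point w = proj_point v" "\<forall>f\<in>S. f w = 0"
    unfolding zero_locus_def by fastforce
  then obtain c where "v = c *s w"
    using proj_point_eq_iff assms(2) by blast
  then show "\<forall>f\<in>S. f v = 0"
    using w assms(1) homogeneous_poly_scale by fastforce
qed (use assms in \<open>auto simp: zero_locus_def\<close>)

lemma zariski_closed_Un:
  assumes "zariski_closed Y" "zariski_closed Z"
  shows "zariski_closed (Y \<union> Z)"
proof -
  obtain S where S: "\<forall>f\<in>S. \<exists>d. homogeneous_poly d f" "Y = zero_locus S"
    using assms(1) unfolding zariski_closed_def by blast
  obtain T where T: "\<forall>f\<in>T. \<exists>d. homogeneous_poly d f" "Z = zero_locus T"
    using assms(2) unfolding zariski_closed_def by blast
  define R where "R = {\<lambda>x. f x * g x | f g. f \<in> S \<and> g \<in> T}"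
  have R: "\<forall>f\<in>R. \<exists>d. homogeneous_poly d f"
    unfolding R_def using S T homogeneous_poly_mult by blast
  have "p \<in> Y \<union> Z \<longleftrightarrow> p \<in> zero_locus R" for p
  proof -
    obtain v where v: "v \<noteq> 0" "p = proj_point v" by (rule proj_point_cases)
    have "(\<forall>f\<in>R. f v = 0) \<longleftrightarrow> (\<forall>f\<in>S. \<forall>g\<in>T. f v * g v = 0)"
      unfolding R_def by fastforce
    then show ?thesis
      unfolding v(2) S(2) T(2) Un_iff proj_point_in_zero_locus[OF R v(1)]
        proj_point_in_zero_locus[OF S(1) v(1)] proj_point_in_zero_locus[OF T(1) v(1)]
      by auto
  qed
  then show ?thesis unfolding zariski_closed_def using R by blast
qed

lemma zariski_closed_Inter:
  assumes "\<And>Z. Z \<in> \<K> \<Longrightarrow> zariski_closed Z"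
  shows "zariski_closed (\<Inter>\<K>)"
proof -
  obtain S where S: "\<And>Z. Z \<in> \<K> \<Longrightarrow> (\<forall>f\<in>S Z. \<exists>d. homogeneous_poly d f) \<and> Z = zero_locus (S Z)"
    using assms unfolding zariski_closed_def by metis
  have R: "\<forall>f\<in>\<Union>(S ` \<K>). \<exists>d. homogeneous_poly d f" using S by blast
  have "p \<in> \<Inter>\<K> \<longleftrightarrow> p \<in> zero_locus (\<Union>(S ` \<K>))" for p
  proof -
    obtain v where v: "v \<noteq> 0" "p = proj_point v" by (rule proj_point_cases)
    have "p \<in> Z \<longleftrightarrow> (\<forall>f\<in>S Z. f v = 0)" if "Z \<in> \<K>" for Z
      using S[OF that] proj_point_in_zero_locus v by metis
    then show ?thesis
      unfolding v(2) proj_point_in_zero_locus[OF R v(1)] by blast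
  qed
  then show ?thesis unfolding zariski_closed_def using R by blast
qed

lemma openin_zariski: "openin zariski U \<longleftrightarrow> zariski_closed (- U)"
proof -
  have "istopology (\<lambda>U. zariski_closed (- U :: ('a, 'b) proj set))"
    unfolding istopology_def
    by (auto simp: Compl_Int zariski_closed_Un uminus_Sup intro!: zariski_closed_Inter)
  then show ?thesis unfolding zariski_def by (simp add: topology_inverse')
qed

lemma topspace_zariski [simp]: "topspace zariski = UNIV"
proof -
  have "zariski_closed (- UNIV :: ('a, 'b) proj set)"
    unfolding zariski_closed_def
  proof (intro exI conjI)
    define o1 :: "'a ^ 'b \<Rightarrow> 'a" where "o1 = (\<lambda>_. 1)"
    have "homogeneous_poly 0 o1"
      unfolding homogeneous_poly_def o1_def
    proof (intro exI allI)
      fix x :: "'a ^ 'b"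
      have "{a :: 'b \<Rightarrow> nat. (\<Sum>i\<in>UNIV. a i) = 0} = {\<lambda>_. 0}" by auto
      then show "1 = (\<Sum>a | (\<Sum>i\<in>UNIV. a i) = 0. (\<lambda>_. 1) a * (\<Prod>i\<in>UNIV. (x $ i) ^ a i))"
        by simp
    qed
    then show "\<forall>f\<in>{o1}. \<exists>d. homogeneous_poly d f" by blast
    show "- UNIV = zero_locus {o1}" by (auto simp: zero_locus_def o1_def)
  qed
  then show ?thesis
    using openin_zariski openin_subset by blast
qed


section \<open>Varieties, regular maps and birational equivalence\<close>

definition zariski_irreducible :: "('k::field, 'n::finite) proj set \<Rightarrow> bool" where
  "zariski_irreducible X \<longleftrightarrow> X \<noteq> {} \<and>
    (\<forall>A B. closedin zariski A \<and> closedin zariski B \<and> X \<subseteq> A \<union> B \<longrightarrow> X \<subseteq> A \<or> X \<subseteq> B)"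

definition projective_variety :: "('k::field, 'n::finite) proj set \<Rightarrow> bool" where
  "projective_variety X \<longleftrightarrow> closedin zariski X \<and> zariski_irreducible X"

definition dense_open_in :: "('k::field, 'n::finite) proj set \<Rightarrow> ('k, 'n) proj set \<Rightarrow> bool" where
  "dense_open_in U X \<longleftrightarrow> openin (subtopology zariski X) U \<and> X \<subseteq> zariski closure_of U"

text \<open>Regular maps to projective space: near each point, given by forms of the same degree
  without common zeros.\<close>

definition regular_map_on ::
    "('k::field, 'n::finite) proj set \<Rightarrow> (('k, 'n) proj \<Rightarrow> ('k, 'm::finite) proj) \<Rightarrow> bool" where
  "regular_map_on U \<phi> \<longleftrightarrow>
    (\<forall>p\<in>U. \<exists>W d F. openin zariski W \<and> p \<in> W \<and> (\<forall>j. homogeneous_poly d (F j)) \<and>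
      (\<forall>v. v \<noteq> 0 \<and> proj_point v \<in> U \<inter> W \<longrightarrow>
        (\<chi> j. F j v) \<noteq> 0 \<and> \<phi> (proj_point v) = proj_point (\<chi> j. F j v)))"

definition birational :: "('k::field, 'n::finite) proj set \<Rightarrow> ('k, 'm::finite) proj set \<Rightarrow> bool" where
  "birational X Y \<longleftrightarrow>
    (\<exists>U V \<phi> \<psi>. dense_open_in U X \<and> dense_open_in V Y \<and>
      regular_map_on U \<phi> \<and> regular_map_on V \<psi> \<and> \<phi> ` U \<subseteq> V \<and> \<psi> ` V \<subseteq> U \<and>
      (\<forall>p\<in>U. \<psi> (\<phi> p) = p) \<and> (\<forall>q\<in>V. \<phi> (\<psi> q) = q))"

text \<open>The index type \<open>4\<close> gives three-dimensional projective space.\<close>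

definition rational_threefold :: "('k::field, 'n::finite) proj set \<Rightarrow> bool" where
  "rational_threefold X \<longleftrightarrow> projective_variety X \<and> birational X (UNIV :: ('k, 4) proj set)"


section \<open>The pencil of quartics\<close>

definition quartic :: "'k::field \<Rightarrow> ('k, 6) proj set" where
  "quartic t = {proj_point x | x. x \<noteq> 0 \<and> (\<Sum>i\<in>UNIV. x $ i) = 0 \<and>
    (\<Sum>i\<in>UNIV. (x $ i) ^ 4) - t * (\<Sum>i\<in>UNIV. (x $ i) ^ 2) ^ 2 = 0}"

end

theory Submission
  imports Defs "HOL-Computational_Algebra.Polynomial"
begin

text \<open>
  For each of the four values of \<open>t\<close> the quartic is determinantal: on the hyperplane where the
  coordinates sum to zero, its equation is a constant times \<open>Q\<^sub>1 Q\<^sub>4 - Q\<^sub>2 Q\<^sub>3\<close> with quadratic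
  forms \<open>Q\<^sub>i\<close>. So \<open>\<kappa> = Q\<^sub>1 / Q\<^sub>2 = Q\<^sub>3 / Q\<^sub>4\<close> maps it to the projective line, and the fibre over
  \<open>\<kappa>\<close> is the intersection of the quadrics \<open>Q\<^sub>1 = \<kappa> Q\<^sub>2\<close> and \<open>Q\<^sub>3 = \<kappa> Q\<^sub>4\<close> in four-dimensional
  space. The presentations below are chosen so that this fibre contains a line \<open>\<ell>\<^sub>\<kappa>\<close> whose
  equations are polynomial in \<open>\<kappa>\<close>. A general plane through \<open>\<ell>\<^sub>\<kappa>\<close> cuts each of the two quadrics in
  \<open>\<ell>\<^sub>\<kappa>\<close> and one further line, and the two further lines meet in one point of the fibre. Hence a
  point of the quartic is determined by \<open>\<kappa>\<close> and by the plane joining it to \<open>\<ell>\<^sub>\<kappa>\<close>, which makes the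
  quartic birational to the product of a line and a plane. The locale \<open>line_pencil\<close> carries this
  out; the map back to the quartic only requires the solution of two linear equations in three
  unknowns.

  The determinantal presentations come from two identities. With \<open>N = x\<^sub>1\<^sup>2 + x\<^sub>1 x\<^sub>2 + x\<^sub>2\<^sup>2\<close>,
  with \<open>e\<close> the second elementary symmetric polynomial of \<open>x\<^sub>3, \<dots>, x\<^sub>6\<close> and \<open>z\<^sub>i = x\<^sub>1 + x\<^sub>2 +
  x\<^sub>i\<close>, lemma \<open>quartic_form_NE\<close> gives the equations \<open>N e = z\<^sub>3 z\<^sub>4 z\<^sub>5 z\<^sub>6\<close> for \<open>t = 1/2\<close>, \<open>(N +
  e)\<^sup>2 = 4 z\<^sub>3 z\<^sub>4 z\<^sub>5 z\<^sub>6\<close> for \<open>t = 1/4\<close> and \<open>N\<^sup>2 + N e + e\<^sup>2 = 3 z\<^sub>3 z\<^sub>4 z\<^sub>5 z\<^sub>6\<close> for \<open>t = 1/6\<close>,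
  whose left-hand sides are products of two quadratic forms, in the last case with a primitive
  cube root of unity among the coefficients. For \<open>t = 7/10\<close>, lemma \<open>quartic_form_total\<close> writes the
  equation as a quadratic form of rank four in the five forms \<open>\<sigma>\<^sub>i\<close> attached to the synthemes of a
  total. The lines \<open>\<ell>\<^sub>\<kappa>\<close> are one ruling of a smooth quadric surface on the quartic, except for \<open>t
  = 1/2\<close>, where they are the lines through a point in a plane on the quartic.

  Two mutually inverse maps between open subsets prove rationality only if the open subset of the
  quartic is dense, and the quartic must be shown to be irreducible. Both follow from lemma
  \<open>vanishing_extends_over_hypersurface\<close>: if a form \<open>h\<close> vanishes at none of the points in which a
  single line not contained in the hypersurface meets it, then every form that vanishes on the
  part of the hypersurface where \<open>h \<noteq> 0\<close> vanishes on all of it. The line and its intersection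
  points are explicit for each of the four quartics.
\<close>

section \<open>Roots in families of polynomials\<close>

text \<open>The hypothesis bounds the multiplicity of each root of \<open>p\<close> by its degree, so the factors \<open>X
  - a\<close> of \<open>p\<close> can be split off one after the other.\<close>
lemma dvd_power_degree_of_roots:
  fixes p q :: "'k::alg_closed_field poly"
  assumes "p \<noteq> 0" "\<And>z. poly p z = 0 \<Longrightarrow> poly q z = 0"
  shows "p dvd q ^ degree p"
  using assms
proof (induction "degree p" arbitrary: p)
  case 0
  then have "is_unit p" by (simp add: is_unit_iff_degree)
  then show ?case by blast
next
  case (Suc n)
  obtain a where a: "poly p a = 0"
    using alg_closed_imp_poly_has_root Suc.hyps(2) by (metis zero_less_Suc)
  then obtain p' where p': "p = [:- a, 1:] * p'"
    using poly_eq_0_iff_dvd by blast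
  have "p' \<noteq> 0" using p' Suc.prems by auto
  have "degree p' = n"
    using degree_mult_eq[of "[:- a, 1:]" p'] p' \<open>p' \<noteq> 0\<close> Suc.hyps(2) by auto
  have "p' dvd q ^ degree p'"
  proof (rule Suc.hyps(1))
    show "n = degree p'" using \<open>degree p' = n\<close> by simp
    show "p' \<noteq> 0" by fact
    show "poly q z = 0" if "poly p' z = 0" for z
      using Suc.prems(2)[of z] that p' by simp
  qed
  moreover have "[:- a, 1:] dvd q"
    using Suc.prems(2)[OF a] poly_eq_0_iff_dvd by blast
  ultimately show ?case
    using mult_dvd_mono[of "[:- a, 1:]" q p' "q ^ degree p'"] p' \<open>degree p' = n\<close>
        Suc.hyps(2)
    by (metis power_Suc)
qed

lemma dvd_cancel_no_common_root:
  fixes p h w :: "'k::alg_closed_field poly"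
  assumes "p \<noteq> 0" "\<And>z. poly p z = 0 \<Longrightarrow> poly h z \<noteq> 0" "p dvd h * w"
  shows "p dvd w"
  using assms
proof (induction "degree p" arbitrary: p w)
  case 0
  then have "is_unit p" by (simp add: is_unit_iff_degree)
  then show ?case by blast
next
  case (Suc n)
  obtain a where a: "poly p a = 0"
    using alg_closed_imp_poly_has_root Suc.hyps(2) by (metis zero_less_Suc)
  then obtain p' where p': "p = [:- a, 1:] * p'"
    using poly_eq_0_iff_dvd by blast
  have "p' \<noteq> 0" using p' Suc.prems by auto
  have "degree p' = n"
    using degree_mult_eq[of "[:- a, 1:]" p'] p' \<open>p' \<noteq> 0\<close> Suc.hyps(2) by auto
  have "poly (h * w) a = 0"
    using Suc.prems(3) a by (metis dvdE mult_zero_left poly_mult)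
  then have "poly w a = 0" using Suc.prems(2)[OF a] by simp
  then obtain w' where w': "w = [:- a, 1:] * w'"
    using poly_eq_0_iff_dvd by blast
  have "[:- a, 1:] * p' dvd [:- a, 1:] * (h * w')"
    using Suc.prems(3) unfolding p' w' by (simp only: mult.left_commute)
  then have "p' dvd h * w'"
    unfolding dvd_mult_cancel_left by auto
  then have "p' dvd w'"
    using Suc.hyps(1)[of p' w'] \<open>degree p' = n\<close> \<open>p' \<noteq> 0\<close>
        Suc.prems(2) p' by simp
  then show ?case unfolding p' w' by (rule mult_dvd_mono[OF dvd_refl])
qed

text \<open>An element of \<open>k[s][z]\<close> is a one-parameter family of polynomials in \<open>z\<close>; this is its member
  at the parameter \<open>s\<close>.\<close>
definition slice :: "'k::field \<Rightarrow> 'k poly poly \<Rightarrow> 'k poly" where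
  "slice s p = map_poly (\<lambda>c. poly c s) p"

lemma coeff_slice [simp]: "coeff (slice s p) i = poly (coeff p i) s"
  unfolding slice_def by (simp add: coeff_map_poly)

lemma slice_pCons [simp]: "slice s (pCons a p) = pCons (poly a s) (slice s p)"
  unfolding slice_def by (simp add: map_poly_pCons)

lemma slice_0 [simp]: "slice s 0 = 0"
  unfolding slice_def by simp

lemma poly_slice: "poly (slice s p) z = poly (poly p [:z:]) s"
  by (induction p) auto

lemma slice_add: "slice s (p + q) = slice s p + slice s q"
  by (rule poly_eqI) simp

lemma slice_mult: "slice s (p * q) = slice s p * slice s (q :: 'k::field_char_0 poly poly)"
  by (rule poly_ext) (simp add: poly_slice)

lemma slice_power: "slice s (p ^ n) = slice s (p :: 'k::field_char_0 poly poly) ^ n"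
  by (rule poly_ext) (simp add: poly_slice)

lemma degree_slice_le: "degree (slice s p) \<le> degree p"
  by (rule degree_le) (simp add: coeff_eq_0)

lemma degree_slice_monic:
  assumes "lead_coeff p = 1"
  shows "degree (slice s p) = degree p" "slice s p \<noteq> 0"
proof -
  have "coeff (slice s p) (degree p) = 1" using assms by simp
  then show "slice s p \<noteq> 0" by (metis coeff_0 zero_neq_one)
  show "degree (slice s p) = degree p"
    using \<open>coeff (slice s p) (degree p) = 1\<close> degree_slice_le[of s p] le_degree
    by (metis antisym zero_neq_one)
qed

lemma slice_eq_0_imp_dvd:
  assumes "slice s p = 0"
  obtains q where "p = smult [:- s, 1:] q"
proof -
  have "\<forall>i. [:- s, 1:] dvd coeff p i"
    using assms by (metis coeff_0 coeff_slice poly_eq_0_iff_dvd)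
  then have "[:[:- s, 1:]:] dvd p" by (simp add: const_poly_dvd_iff)
  then obtain q where "p = [:[:- s, 1:]:] * q" ..
  then have "p = smult [:- s, 1:] q" by simp
  then show ?thesis by (rule that)
qed

text \<open>Pseudo-division multiplies the dividend by a power of the leading coefficient of the
  divisor, which here is \<open>1\<close>.\<close>
lemma monic_division:
  fixes p g :: "'a::idom poly"
  assumes "lead_coeff p = 1"
  obtains q r where "g = p * q + r" "r = 0 \<or> degree r < degree p"
proof -
  have "p \<noteq> 0" using assms by auto
  obtain q r where "pseudo_divmod g p = (q, r)" by (cases "pseudo_divmod g p")
  from pseudo_divmod[OF \<open>p \<noteq> 0\<close> this] assms show ?thesis using that by simp
qed

text \<open>The remainder of \<open>g ^ degree p\<close> modulo \<open>p\<close> vanishes at every parameter, because there it is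
  a multiple of a polynomial of larger degree.\<close>
lemma dvd_power_of_slice_roots:
  fixes p g :: "'k::{alg_closed_field, field_char_0} poly poly"
  assumes monic: "lead_coeff p = 1"
    and roots: "\<And>s z. poly (slice s p) z = 0 \<Longrightarrow> poly (slice s g) z = 0"
  shows "p dvd g ^ degree p"
proof -
  obtain q r where qr: "g ^ degree p = p * q + r" "r = 0 \<or> degree r < degree p"
    using monic_division[OF monic] .
  have "slice s r = 0" for s
  proof (rule ccontr)
    assume nz: "slice s r \<noteq> 0"
    have "slice s p dvd slice s g ^ degree p"
      using dvd_power_degree_of_roots[of "slice s p" "slice s g"] degree_slice_monic[OF monic] roots
      by metis
    also have "slice s g ^ degree p = slice s p * slice s q + slice s r"
      using qr(1) by (metis slice_power slice_mult slice_add)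
    finally have "slice s p dvd slice s r" by (simp add: dvd_add_right_iff)
    then have "degree p \<le> degree (slice s r)"
      using dvd_imp_degree_le nz degree_slice_monic[OF monic] by metis
    then show False using qr(2) nz degree_slice_le[of s r] by auto
  qed
  then have "poly (coeff r i) s = 0" for i s by (metis coeff_0 coeff_slice)
  then have "r = 0" by (metis poly_all_0_iff_0 poly_eqI coeff_0)
  then show ?thesis using qr by simp
qed

text \<open>Multiplication by \<open>h\<close> is injective modulo the monic polynomial \<open>p\<close> as soon as \<open>p\<close> and \<open>h\<close>
  have no common root at one single parameter \<open>s\<close>: a nonzero \<open>w\<close> in the kernel would have to
  vanish at \<open>s\<close>, and dividing by the corresponding linear polynomial gives an element of the
  kernel with coefficients of smaller degree.\<close>
lemma small_multiple_eq_0: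
  fixes p h w :: "'k::{alg_closed_field, field_char_0} poly poly"
  assumes monic: "lead_coeff p = 1"
    and no_common: "\<And>z. poly (slice s p) z = 0 \<Longrightarrow> poly (slice s h) z \<noteq> 0"
    and "p dvd h * w" "degree w < degree p"
  shows "w = 0"
proof (rule ccontr)
  assume "w \<noteq> 0"
  then obtain i where "coeff w i \<noteq> 0" using leading_coeff_0_iff by blast
  then show False
    using assms(3,4)
  proof (induction "degree (coeff w i)" arbitrary: w rule: less_induct)
    case (less w)
    have "slice s p dvd slice s h * slice s w"
      using less.prems(2) by (metis dvd_def slice_mult)
    then have "slice s p dvd slice s w"
      using dvd_cancel_no_common_root degree_slice_monic[OF monic] no_common by blast
    then have "slice s w = 0"
      using dvd_imp_degree_le[of "slice s p" "slice s w"] degree_slice_monic[OF monic, of s]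
        degree_slice_le[of s w] less.prems(3) by fastforce
    then obtain w' where w': "w = smult [:- s, 1:] w'" by (rule slice_eq_0_imp_dvd)
    obtain u where u: "h * w = p * u" using less.prems(2) by blast
    have "slice s p * slice s u = 0"
      using u \<open>slice s w = 0\<close> by (metis slice_mult mult_zero_right)
    then have "slice s u = 0" using degree_slice_monic[OF monic] by auto
    then obtain u' where u': "u = smult [:- s, 1:] u'" by (rule slice_eq_0_imp_dvd)
    have "smult [:- s, 1:] (h * w') = smult [:- s, 1:] (p * u')"
      using u by (simp add: w' u')
    then have "h * w' = p * u'" by (metis smult_eq_iff pCons_eq_0_iff one_neq_zero smult_cancel)
    have cw: "coeff w i = [:- s, 1:] * coeff w' i" using w' by simp
    show False
    proof (rule less.hyps)
      show "coeff w' i \<noteq> 0" using cw less.prems(1) by auto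
      then show "degree (coeff w' i) < degree (coeff w i)"
        unfolding cw by (subst degree_mult_eq) auto
      show "p dvd h * w'" using \<open>h * w' = p * u'\<close> by simp
      have "degree w = degree w'" unfolding w' by (rule degree_smult_eq[THEN trans]) simp
      then show "degree w' < degree p" using less.prems(3) by simp
    qed
  qed
qed

text \<open>The case of a family of finite sets. Write \<open>g ^ n\<close> as a multiple of \<open>p\<close> plus a remainder
  \<open>w\<close>. The hypothesis makes \<open>h ^ n * w\<close> a multiple of \<open>p\<close>, and then \<open>w = 0\<close> by injectivity.\<close>
lemma vanishing_extends_over_family:
  fixes p h g :: "'k::{alg_closed_field, field_char_0} poly poly"
  assumes monic: "lead_coeff p = 1"
    and no_common: "\<And>z. poly (slice s\<^sub>0 p) z = 0 \<Longrightarrow> poly (slice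
        s\<^sub>0 h) z \<noteq> 0"
    and vanish: "\<And>s z. poly (slice s p) z = 0 \<Longrightarrow> poly (slice s (g * h)) z = 0"
    and "poly (slice s p) z = 0"
  shows "poly (slice s g) z = 0"
proof -
  define n where "n = degree p"
  have "degree p \<noteq> 0"
  proof
    assume "degree p = 0"
    then have "p = 1" using monic by (metis degree_0_id one_pCons)
    then show False using assms(4) by (simp add: poly_slice)
  qed
  have "p dvd (g * h) ^ n"
    unfolding n_def by (rule dvd_power_of_slice_roots[OF monic vanish])
  obtain q w where qw: "g ^ n = p * q + w" "w = 0 \<or> degree w < degree p"
    using monic_division[OF monic] .
  have "h ^ n * w = (g * h) ^ n - p * (q * h ^ n)"
    using qw(1) by (simp add: power_mult_distrib algebra_simps)
  then have "p dvd h ^ n * w"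
    using \<open>p dvd (g * h) ^ n\<close> by (metis dvd_diff dvd_triv_left)
  moreover have "poly (slice s\<^sub>0 (h ^ n)) z \<noteq> 0" if "poly (slice s\<^sub>0 p) z = 0"
      for z
    using no_common[OF that] by (simp add: slice_power)
  ultimately have "w = 0"
    using small_multiple_eq_0[OF monic] qw(2) by blast
  then have "slice s g ^ n = slice s p * slice s q"
    using qw(1) by (metis slice_power slice_mult add.right_neutral)
  then have "poly (slice s g) z ^ n = poly (slice s p) z * poly (slice s q) z"
    by (metis poly_power poly_mult)
  then show ?thesis using assms(4) by simp
qed

section \<open>Forms\<close>

lemma homogeneous_poly_const: "homogeneous_poly 0 (\<lambda>_. c)"
proof -
  have "{a :: 'b \<Rightarrow> nat. (\<Sum>i\<in>UNIV. a i) = 0} = {\<lambda>_. 0}" by auto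
  then show ?thesis
    unfolding homogeneous_poly_def by (intro exI[of _ "\<lambda>_. c"]) simp
qed

lemma homogeneous_poly_coord: "homogeneous_poly 1 (\<lambda>x :: 'k::field ^ 'n. x $ i)"
  unfolding homogeneous_poly_def
proof (intro exI allI)
  fix x :: "'k ^ 'n"
  define e where "e = (\<lambda>j. if j = i then 1 else 0 :: nat)"
  have e: "e \<in> {a. (\<Sum>i\<in>UNIV. a i) = 1}" by (simp add: e_def)
  have "(\<Sum>a | (\<Sum>i\<in>UNIV. a i) = 1. (if a = e then 1 else 0) * (\<Prod>j\<in>UNIV. (x
      $ j) ^ a j))
      = (\<Sum>a | (\<Sum>i\<in>UNIV. a i) = 1. if a = e then (\<Prod>j\<in>UNIV. (x $ j) ^ e j)
          else 0)"
    by (intro sum.cong) auto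
  also have "\<dots> = (\<Prod>j\<in>UNIV. (x $ j) ^ e j)"
    using e by (subst sum.delta[OF finite_exponents]) auto
  also have "\<dots> = (\<Prod>j\<in>UNIV. if j = i then x $ i else 1)"
    by (intro prod.cong) (auto simp: e_def)
  also have "\<dots> = x $ i" by simp
  finally show "x $ i = (\<Sum>a | (\<Sum>i\<in>UNIV. a i) = 1.
      (if a = e then 1 else 0) * (\<Prod>j\<in>UNIV. (x $ j) ^ a j))" ..
qed

lemma homogeneous_poly_add:
  assumes "homogeneous_poly d f" "homogeneous_poly d g"
  shows "homogeneous_poly d (\<lambda>x. f x + g x)"
proof -
  obtain k where "\<And>x. f x = (\<Sum>a | (\<Sum>i\<in>UNIV. a i) = d. k a * (\<Prod>i\<in>UNIV.
      (x $ i) ^ a i))"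
    using assms(1) unfolding homogeneous_poly_def by blast
  moreover obtain l where
    "\<And>x. g x = (\<Sum>a | (\<Sum>i\<in>UNIV. a i) = d. l a * (\<Prod>i\<in>UNIV. (x $ i) ^ a
        i))"
    using assms(2) unfolding homogeneous_poly_def by blast
  ultimately show ?thesis
    unfolding homogeneous_poly_def
    by (intro exI[of _ "\<lambda>a. k a + l a"]) (simp add: sum.distrib distrib_right)
qed

lemma homogeneous_poly_cmult:
  assumes "homogeneous_poly d f"
  shows "homogeneous_poly d (\<lambda>x. c * f x)"
  using homogeneous_poly_mult[OF homogeneous_poly_const assms] by simp

lemma homogeneous_poly_times_const:
  "homogeneous_poly d f \<Longrightarrow> homogeneous_poly d (\<lambda>x. f x * c)"
  using homogeneous_poly_cmult[of d f c] by (simp add: mult.commute)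

lemma homogeneous_poly_zero: "homogeneous_poly d (\<lambda>_. 0)"
  unfolding homogeneous_poly_def by (intro exI[of _ "\<lambda>_. 0"]) simp

lemma homogeneous_poly_diff:
  assumes "homogeneous_poly d f" "homogeneous_poly d g"
  shows "homogeneous_poly d (\<lambda>x. f x - g x)"
  using homogeneous_poly_add[OF assms(1) homogeneous_poly_cmult[OF assms(2), of "-1"]] by simp

lemma homogeneous_poly_sum:
  assumes "\<And>a. a \<in> A \<Longrightarrow> homogeneous_poly d (f a)"
  shows "homogeneous_poly d (\<lambda>x. \<Sum>a\<in>A. f a x)"
  using assms
  by (induction A rule: infinite_finite_induct) (auto intro: homogeneous_poly_zero
      homogeneous_poly_add)

lemma homogeneous_poly_power:
  assumes "homogeneous_poly d f"
  shows "homogeneous_poly (d * n) (\<lambda>x. f x ^ n)"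
proof (induction n)
  case 0
  show ?case by (simp add: homogeneous_poly_const)
next
  case (Suc n)
  show ?case using homogeneous_poly_mult[OF assms Suc] by simp
qed

lemma homogeneous_poly_prod:
  assumes "\<And>a. a \<in> A \<Longrightarrow> homogeneous_poly (d a) (f a)"
  shows "homogeneous_poly (\<Sum>a\<in>A. d a) (\<lambda>x. \<Prod>a\<in>A. f a x)"
  using assms
  by (induction A rule: infinite_finite_induct)
    (auto intro: homogeneous_poly_const homogeneous_poly_mult)

lemma homogeneous_poly_comp:
  fixes F :: "'k::field ^ 'm \<Rightarrow> 'k ^ 'n"
  assumes "homogeneous_poly d f" "\<And>i. homogeneous_poly e (\<lambda>x. F x $ i)"
  shows "homogeneous_poly (e * d) (\<lambda>x. f (F x))"
proof -
  obtain k where k: "\<And>x. f x = (\<Sum>a | (\<Sum>i\<in>UNIV. a i) = d. k a *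
      (\<Prod>i\<in>UNIV. (x $ i) ^ a i))"
    using assms(1) unfolding homogeneous_poly_def by blast
  have "homogeneous_poly (e * d) (\<lambda>x. k a * (\<Prod>i\<in>UNIV. (F x $ i) ^ a i))"
    if "(\<Sum>i\<in>UNIV. a i) = d" for a
  proof -
    have "homogeneous_poly (\<Sum>i\<in>UNIV. e * a i) (\<lambda>x. \<Prod>i\<in>UNIV. (F x $ i) ^
        a i)"
      by (intro homogeneous_poly_prod homogeneous_poly_power assms(2))
    then show ?thesis
      using that by (auto intro: homogeneous_poly_cmult simp: sum_distrib_left[symmetric])
  qed
  then show ?thesis
    unfolding k by (intro homogeneous_poly_sum) auto
qed

lemma coeff_mult_top:
  fixes p q :: "'a::comm_semiring_0 poly"
  assumes "degree p \<le> m" "degree q \<le> n"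
  shows "coeff (p * q) (m + n) = coeff p m * coeff q n"
proof -
  have "coeff (p * q) (m + n) = (\<Sum>i\<le>m + n. coeff p i * coeff q (m + n - i))"
    by (rule coeff_mult)
  also have "\<dots> = (\<Sum>i\<le>m + n. if i = m then coeff p m * coeff q n else 0)"
  proof (intro sum.cong refl)
    fix i assume "i \<in> {..m + n}"
    consider "i < m" | "i = m" | "i > m" by linarith
    then show "coeff p i * coeff q (m + n - i) = (if i = m then coeff p m * coeff q n else 0)"
      by cases (use assms in \<open>auto simp: coeff_eq_0\<close>)
  qed
  finally show ?thesis by simp
qed

text \<open>The coefficient of \<open>z ^ d\<close> does not involve \<open>s\<close>, so that \<open>p\<close> is monic up to a constant
  whenever \<open>w\<close> does not lie on the hypersurface.\<close>
lemma homogeneous_poly_on_plane: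
  fixes f :: "'k::field ^ 'n \<Rightarrow> 'k"
  assumes "homogeneous_poly d f"
  shows "\<exists>p. (\<forall>s z. poly (slice s p) z = f (u + s *s v + z *s w)) \<and>
    degree p \<le> d \<and> coeff p d = [:f w:]"
proof -
  obtain k where k: "\<And>x. f x = (\<Sum>a | (\<Sum>i\<in>UNIV. a i) = d. k a *
      (\<Prod>i\<in>UNIV. (x $ i) ^ a i))"
    using assms unfolding homogeneous_poly_def by blast
  define l where "l = (\<lambda>i. [:[:u $ i, v $ i:], [:w $ i:]:])"
  have pow: "degree (l i ^ m) \<le> m \<and> coeff (l i ^ m) m = [:(w $ i) ^ m:]" for i m
  proof (induction m)
    case (Suc m)
    have "degree (l i * l i ^ m) \<le> 1 + m"
      by (rule degree_mult_le[THEN order_trans]) (use Suc in \<open>auto simp: l_def intro!: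
          add_mono\<close>)
    moreover have "coeff (l i * l i ^ m) (1 + m) = coeff (l i) 1 * coeff (l i ^ m) m"
      by (rule coeff_mult_top) (use Suc in \<open>auto simp: l_def\<close>)
    ultimately show ?case using Suc by (simp add: l_def)
  qed simp
  have mono: "degree (\<Prod>i\<in>A. l i ^ a i) \<le> (\<Sum>i\<in>A. a i) \<and>
      coeff (\<Prod>i\<in>A. l i ^ a i) (\<Sum>i\<in>A. a i) = [:\<Prod>i\<in>A. (w $ i) ^ a i:]"
    if "finite A" for A :: "'n set" and a
    using that
  proof induction
    case (insert i A)
    have "degree (l i ^ a i * (\<Prod>i\<in>A. l i ^ a i)) \<le> a i + (\<Sum>i\<in>A. a i)"
      by (rule degree_mult_le[THEN order_trans]) (use insert pow in \<open>auto intro!: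
          add_mono\<close>)
    moreover have "coeff (l i ^ a i * (\<Prod>i\<in>A. l i ^ a i)) (a i + (\<Sum>i\<in>A. a i))
        = coeff (l i ^ a i) (a i) * coeff (\<Prod>i\<in>A. l i ^ a i) (\<Sum>i\<in>A. a i)"
      by (rule coeff_mult_top) (use insert pow in auto)
    ultimately show ?case using insert pow by simp
  qed simp
  define p where "p = (\<Sum>a | (\<Sum>i\<in>UNIV. a i) = d. smult [:k a:] (\<Prod>i\<in>UNIV. l
      i ^ a i))"
  show ?thesis
  proof (intro exI[of _ p] conjI allI)
    show "poly (slice s p) z = f (u + s *s v + z *s w)" for s z
      unfolding p_def l_def k poly_slice
      by (simp add: poly_sum poly_prod algebra_simps)
    show "degree p \<le> d"
      unfolding p_def
      by (intro degree_sum_le finite_exponents degree_smult_le[THEN order_trans])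
        (use mono[of UNIV] in auto)
    have "coeff p d = (\<Sum>a | (\<Sum>i\<in>UNIV. a i) = d. [:k a:] * coeff (\<Prod>i\<in>UNIV.
        l i ^ a i) d)"
      unfolding p_def by (simp add: coeff_sum)
    also have "\<dots> = (\<Sum>a | (\<Sum>i\<in>UNIV. a i) = d. [:k a * (\<Prod>i\<in>UNIV. (w $
        i) ^ a i):])"
      by (intro sum.cong refl) (use mono[of UNIV] in auto)
    also have "\<dots> = [:f w:]"
    proof -
      have "(\<Sum>a\<in>S. [:g a:]) = [:\<Sum>a\<in>S. g a:]" for S and g :: "('n \<Rightarrow>
          nat) \<Rightarrow> 'k"
        by (induction S rule: infinite_finite_induct) auto
      then show ?thesis unfolding k .
    qed
    finally show "coeff p d = [:f w:]" .
  qed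
qed

text \<open>Irreducibility of projective space: restrict both forms to the line through \<open>u\<close> and \<open>v\<close>.\<close>
lemma common_nonzero:
  fixes f g :: "'k::field_char_0 ^ 'n \<Rightarrow> 'k"
  assumes "homogeneous_poly d f" "homogeneous_poly e g" "f u \<noteq> 0" "g v \<noteq> 0"
  obtains w where "f w \<noteq> 0" "g w \<noteq> 0"
proof -
  obtain p where p: "\<And>s z. poly (slice s p) z = f (u + s *s (v - u) + z *s 0)"
    using homogeneous_poly_on_plane[OF assms(1), of u "v - u" 0] by metis
  obtain q where q: "\<And>s z. poly (slice s q) z = g (u + s *s (v - u) + z *s 0)"
    using homogeneous_poly_on_plane[OF assms(2), of u "v - u" 0] by metis
  have p': "poly (coeff p 0) s = f (u + s *s (v - u))" for s
    using p[of s 0] by (simp add: poly_0_coeff_0)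
  have q': "poly (coeff q 0) s = g (u + s *s (v - u))" for s
    using q[of s 0] by (simp add: poly_0_coeff_0)
  have "coeff p 0 \<noteq> 0" using p'[of 0] assms(3) by auto
  moreover have "coeff q 0 \<noteq> 0" using q'[of 1] assms(4) by auto
  ultimately have "coeff p 0 * coeff q 0 \<noteq> 0" by simp
  then obtain s where "poly (coeff p 0 * coeff q 0) s \<noteq> 0"
    using poly_all_0_iff_0 by blast
  then have "f (u + s *s (v - u)) \<noteq> 0" "g (u + s *s (v - u)) \<noteq> 0"
    using p'[of s] q'[of s] by auto
  then show ?thesis by (rule that)
qed

text \<open>The plane through \<open>x\<close> and the line \<open>x\<^sub>0 + z w\<close> is swept out by lines of direction \<open>w\<close>, one
  of them through \<open>x\<close> and another one the given line. Since \<open>f w \<noteq> 0\<close>, the restrictions of \<open>f\<close> to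
  these lines form a family of polynomials that is monic up to a constant. The linear space \<open>L\<close>
  allows hypersurfaces of a subspace.\<close>
lemma vanishing_extends_over_hypersurface:
  fixes f g h :: "'k::{alg_closed_field, field_char_0} ^ 'n \<Rightarrow> 'k"
  assumes f: "homogeneous_poly n f" and g: "homogeneous_poly d g" and h: "homogeneous_poly e h"
    and L: "\<And>x y c. x \<in> L \<Longrightarrow> y \<in> L \<Longrightarrow> x + c *s y \<in> L"
    and "x\<^sub>0 \<in> L" "w \<in> L" "f w \<noteq> 0"
    and good: "\<And>z. f (x\<^sub>0 + z *s w) = 0 \<Longrightarrow> h (x\<^sub>0 + z *s w)
        \<noteq> 0"
    and vanish: "\<And>x. x \<in> L \<Longrightarrow> f x = 0 \<Longrightarrow> g x * h x = 0"
    and x: "x \<in> L" "f x = 0"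
  shows "g x = 0"
proof -
  \<comment> \<open>At \<open>s = 0\<close> the line passes through \<open>x\<close>, and at \<open>s = 1\<close> it is the given line.\<close>
  define v where "v = x\<^sub>0 - x"
  have inL: "x + s *s v + z *s w \<in> L" for s z
  proof -
    have "x\<^sub>0 + (-1) *s x \<in> L" using L assms(5) x(1) by blast
    then have "v \<in> L" unfolding v_def by simp
    then show ?thesis using L x(1) assms(6) by blast
  qed
  obtain p where p: "\<And>s z. poly (slice s p) z = f (x + s *s v + z *s w)"
    and top: "degree p \<le> n" "coeff p n = [:f w:]"
    using homogeneous_poly_on_plane[OF f, of x v w] by metis
  obtain q where q: "\<And>s z. poly (slice s q) z = g (x + s *s v + z *s w)"
    using homogeneous_poly_on_plane[OF g, of x v w] by metis
  obtain r where r: "\<And>s z. poly (slice s r) z = h (x + s *s v + z *s w)"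
    using homogeneous_poly_on_plane[OF h, of x v w] by metis
  define p' where "p' = smult [:inverse (f w):] p"
  have p': "poly (slice s p') z = inverse (f w) * f (x + s *s v + z *s w)" for s z
    unfolding p[symmetric] p'_def poly_slice by simp
  have "coeff p' n = 1" unfolding p'_def using top(2) \<open>f w \<noteq> 0\<close> by (simp add:
      one_pCons)
  moreover have "degree p' \<le> n"
    unfolding p'_def using degree_smult_le top(1) order_trans by blast
  ultimately have monic: "lead_coeff p' = 1"
    by (metis antisym le_degree zero_neq_one)
  have "poly (slice 0 q) 0 = 0"
  proof (rule vanishing_extends_over_family[OF monic])
    show "poly (slice 1 r) z \<noteq> 0" if "poly (slice 1 p') z = 0" for z
      using that good[of z] \<open>f w \<noteq> 0\<close> by (simp add: p' r v_def)
    show "poly (slice s (q * r)) z = 0" if "poly (slice s p') z = 0" for s z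
      using that vanish[OF inL, of s z] \<open>f w \<noteq> 0\<close> by (simp add: p' q r
          slice_mult)
    show "poly (slice 0 p') 0 = 0" using x(2) by (simp add: p')
  qed
  then show ?thesis by (simp add: q)
qed

section \<open>A rationality criterion\<close>

text \<open>This is the equation of the quartic on the hyperplane \<open>coord_sum x = 0\<close>.\<close>
definition quartic_form :: "'k::field \<Rightarrow> 'k ^ 'n \<Rightarrow> 'k" where
  "quartic_form t x = (\<Sum>i\<in>UNIV. (x $ i) ^ 4) - t * (\<Sum>i\<in>UNIV. (x $ i) ^ 2) ^ 2"

definition coord_sum :: "'k::field ^ 'n \<Rightarrow> 'k" where
  "coord_sum x = (\<Sum>i\<in>UNIV. x $ i)"

lemma coord_sum_add: "coord_sum (x + c *s y) = coord_sum x + c * coord_sum y"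
  unfolding coord_sum_def by (simp add: sum.distrib sum_distrib_left)

lemma coord_sum_plus: "coord_sum (x + y) = coord_sum x + coord_sum y"
  using coord_sum_add[of x 1 y] by simp

lemma coord_sum_scale: "coord_sum (c *s y) = c * coord_sum y"
  unfolding coord_sum_def by (simp add: sum_distrib_left)

lemma homogeneous_poly_coord_sum: "homogeneous_poly 1 (coord_sum :: 'k::field ^ 'n \<Rightarrow>
    'k)"
  unfolding coord_sum_def[abs_def] by (intro homogeneous_poly_sum homogeneous_poly_coord)

lemma homogeneous_poly_quartic_form: "homogeneous_poly 4 (quartic_form t :: 'k::field ^ 'n
    \<Rightarrow> 'k)"
proof -
  have "homogeneous_poly m (\<lambda>x :: 'k ^ 'n. \<Sum>i\<in>UNIV. (x $ i) ^ m)" for m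
    using homogeneous_poly_power[OF homogeneous_poly_coord, of m]
    by (intro homogeneous_poly_sum) auto
  from this[of 4] homogeneous_poly_power[OF this[of 2], of 2] show ?thesis
    unfolding quartic_form_def[abs_def]
    by (intro homogeneous_poly_diff homogeneous_poly_cmult) auto
qed

lemma quartic_alt:
  "quartic t = {proj_point x | x. x \<noteq> 0 \<and> coord_sum x = 0 \<and> quartic_form t x = 0}"
  unfolding quartic_def quartic_form_def coord_sum_def ..

lemma quartic_eq_zero_locus: "quartic t = zero_locus {coord_sum, quartic_form t}"
  unfolding quartic_alt zero_locus_def by auto

lemma proj_point_in_quartic:
  assumes "x \<noteq> 0"
  shows "proj_point x \<in> quartic t \<longleftrightarrow> coord_sum x = 0 \<and> quartic_form t
      x = 0"
  unfolding quartic_eq_zero_locus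
  by (subst proj_point_in_zero_locus)
    (use assms homogeneous_poly_coord_sum homogeneous_poly_quartic_form in auto)

lemma closedin_zariski: "closedin zariski A \<longleftrightarrow> zariski_closed A"
  unfolding closedin_def openin_zariski by (simp add: Compl_eq_Diff_UNIV[symmetric])

lemma zariski_open_avoids_form:
  assumes "openin zariski W" "proj_point v \<in> W" "v \<noteq> 0"
  obtains f d where "homogeneous_poly d f" "f v \<noteq> 0" "\<And>x. x \<noteq> 0
      \<Longrightarrow> f x \<noteq> 0 \<Longrightarrow> proj_point x \<in> W"
proof -
  obtain S where S: "\<forall>f\<in>S. \<exists>d. homogeneous_poly d f" "- W = zero_locus S"
    using assms(1) unfolding openin_zariski zariski_closed_def by blast
  have in_W: "proj_point x \<in> W \<longleftrightarrow> (\<exists>f\<in>S. f x \<noteq> 0)" if "x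
      \<noteq> 0" for x
    using proj_point_in_zero_locus[OF S(1) that] S(2) by blast
  then obtain f where f: "f \<in> S" "f v \<noteq> 0" using assms(2,3) by blast
  show ?thesis
    using that[of _ f] f S(1) in_W by blast
qed

lemma openin_zariski_nonzero:
  assumes "homogeneous_poly d h"
  shows "openin zariski (- zero_locus {h})"
  unfolding openin_zariski zariski_closed_def
  by (intro exI[of _ "{h}"]) (use assms in auto)

lemma dense_open_in_nonzero_quartic:
  fixes h :: "'k::{alg_closed_field, field_char_0} ^ 6 \<Rightarrow> 'k"
  assumes h: "homogeneous_poly e h"
    and line: "coord_sum x\<^sub>0 = 0" "coord_sum w = 0" "quartic_form t w \<noteq> 0"
      "\<And>z. quartic_form t (x\<^sub>0 + z *s w) = 0 \<Longrightarrow> h (x\<^sub>0 + z *s w)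
          \<noteq> 0"
  shows "dense_open_in (quartic t - zero_locus {h}) (quartic t)"
  unfolding dense_open_in_def
proof
  show "openin (subtopology zariski (quartic t)) (quartic t - zero_locus {h})"
    using openin_zariski_nonzero[OF h] by (auto simp: openin_subtopology)
  show "quartic t \<subseteq> zariski closure_of (quartic t - zero_locus {h})"
  proof (rule subsetI, unfold in_closure_of, intro conjI allI impI)
    fix p :: "('k, 6) proj" and W
    assume "p \<in> quartic t" and W: "p \<in> W \<and> openin zariski W"
    then obtain v where v: "p = proj_point v" "v \<noteq> 0" "coord_sum v = 0" "quartic_form t v =
        0"
      unfolding quartic_alt by blast
    obtain f d where f: "homogeneous_poly d f" "f v \<noteq> 0"
      "\<And>x. x \<noteq> 0 \<Longrightarrow> f x \<noteq> 0 \<Longrightarrow> proj_point x \<in>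
          W"
      using zariski_open_avoids_form W v(1,2) by metis
    have "\<exists>x. x \<noteq> 0 \<and> coord_sum x = 0 \<and> quartic_form t x = 0 \<and> f x *
        h x \<noteq> 0"
    proof (rule ccontr)
      assume none: "\<not> ?thesis"
      obtain i where i: "v $ i \<noteq> 0" using v(2) by (auto simp: vec_eq_iff)
      \<comment> \<open>The factor \<open>x $ i\<close> makes the form vanish at the origin, which is not a point of
          projective space.\<close>
      have "f v * v $ i = 0"
      proof (rule vanishing_extends_over_hypersurface[where L = "{x. coord_sum x = 0}" and
            f = "quartic_form t" and h = h and g = "\<lambda>x. f x * x $ i"])
        show "homogeneous_poly (d + 1) (\<lambda>x. f x * x $ i)"
          by (intro homogeneous_poly_mult f homogeneous_poly_coord)
        show "f x * x $ i * h x = 0" if "x \<in> {x. coord_sum x = 0}" "quartic_form t x = 0" for x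
          using none that by (cases "x = 0") auto
      qed (use h line v homogeneous_poly_quartic_form in \<open>auto simp: coord_sum_add\<close>)
      then show False using i f(2) by simp
    qed
    then obtain x where x: "x \<noteq> 0" "coord_sum x = 0" "quartic_form t x = 0" "f x \<noteq>
        0" "h x \<noteq> 0"
      by auto
    then have "proj_point x \<in> quartic t - zero_locus {h}"
      using h by (subst Diff_iff) (subst proj_point_in_quartic proj_point_in_zero_locus; auto)+
    then show "\<exists>y. y \<in> quartic t - zero_locus {h} \<and> y \<in> W" using f(3) x by
        blast
  qed simp
qed

lemma dense_open_in_nonzero_UNIV:
  fixes h :: "'k::field_char_0 ^ 'n::finite \<Rightarrow> 'k"
  assumes h: "homogeneous_poly e h" and "h y\<^sub>0 \<noteq> 0"
  shows "dense_open_in (- zero_locus {h}) UNIV"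
  unfolding dense_open_in_def
proof
  show "openin (subtopology zariski UNIV) (- zero_locus {h})"
    using openin_zariski_nonzero[OF h] by simp
  show "UNIV \<subseteq> zariski closure_of (- zero_locus {h})"
  proof (rule subsetI, unfold in_closure_of, intro conjI allI impI)
    fix p :: "('k, 'n) proj" and W
    assume W: "p \<in> W \<and> openin zariski W"
    obtain v where v: "v \<noteq> 0" "p = proj_point v" by (rule proj_point_cases)
    obtain f d where f: "homogeneous_poly d f" "f v \<noteq> 0"
      "\<And>x. x \<noteq> 0 \<Longrightarrow> f x \<noteq> 0 \<Longrightarrow> proj_point x \<in>
          W"
      using zariski_open_avoids_form W v by metis
    obtain i where i: "v $ i \<noteq> 0" using v(1) by (auto simp: vec_eq_iff)
    obtain x where x: "f x * x $ i \<noteq> 0" "h x \<noteq> 0"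
      using common_nonzero[OF homogeneous_poly_mult[OF f(1) homogeneous_poly_coord[of i]] h, of v
          y\<^sub>0]
        i f(2) \<open>h y\<^sub>0 \<noteq> 0\<close> by auto
    then have "x \<noteq> 0" by auto
    then have "proj_point x \<notin> zero_locus {h}"
      using x h by (subst proj_point_in_zero_locus) auto
    then show "\<exists>y. y \<in> - zero_locus {h} \<and> y \<in> W" using f(3) x \<open>x
        \<noteq> 0\<close> by auto
  qed simp
qed

lemma regular_map_on_form_map:
  fixes F :: "'k::field ^ 'n::finite \<Rightarrow> 'k ^ 'm::finite"
  assumes F: "\<And>j. homogeneous_poly d (\<lambda>x. F x $ j)"
    and nz: "\<And>x. x \<noteq> 0 \<Longrightarrow> proj_point x \<in> U \<Longrightarrow> F x
        \<noteq> 0"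
  obtains \<phi> where "regular_map_on U \<phi>"
    "\<And>x. x \<noteq> 0 \<Longrightarrow> proj_point x \<in> U \<Longrightarrow> \<phi>
        (proj_point x) = proj_point (F x)"
proof -
  define r :: "('k, 'n) proj \<Rightarrow> 'k ^ 'n" where "r = (\<lambda>p. SOME v. v \<noteq> 0
      \<and> p = proj_point v)"
  define \<phi> where "\<phi> = (\<lambda>p. proj_point (F (r p)))"
  have r: "r p \<noteq> 0 \<and> p = proj_point (r p)" for p
    unfolding r_def by (rule someI_ex) (metis proj_point_cases)
  have \<phi>: "\<phi> (proj_point x) = proj_point (F x)" if x: "x \<noteq> 0" "proj_point x \<in>
      U" for x
  proof -
    obtain c where c: "c \<noteq> 0" "r (proj_point x) = c *s x"
      using r[of "proj_point x"] proj_point_eq_iff[of x "r (proj_point x)"] x(1) by metis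
    have "F (c *s x) = c ^ d *s F x"
      using homogeneous_poly_scale[OF F] by (simp add: vec_eq_iff)
    moreover have "c ^ d \<noteq> 0" using c(1) by simp
    ultimately show ?thesis
      unfolding \<phi>_def c(2) using nz[OF x] proj_point_eq_iff[of "F x" "c ^ d *s F x"]
      by (metis vector_mul_eq_0)
  qed
  have "regular_map_on U \<phi>"
    unfolding regular_map_on_def
  proof
    fix p assume "p \<in> U"
    show "\<exists>W d F. openin zariski W \<and> p \<in> W \<and> (\<forall>j. homogeneous_poly d
        (F j)) \<and>
      (\<forall>v. v \<noteq> 0 \<and> proj_point v \<in> U \<inter> W \<longrightarrow>
        (\<chi> j. F j v) \<noteq> 0 \<and> \<phi> (proj_point v) = proj_point (\<chi> j. F j v))"
      by (intro exI[of _ UNIV] exI[of _ d] exI[of _ "\<lambda>j x. F x $ j"])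
        (use F nz \<phi> openin_topspace[of zariski] in \<open>auto simp: vec_lambda_eta\<close>)
  qed
  then show ?thesis using that \<phi> by blast
qed

text \<open>\<open>F\<close> and \<open>G\<close> induce mutually inverse maps between the open sets \<open>a x * b (F x) \<noteq> 0\<close> and \<open>b y
  * a (G y) \<noteq> 0\<close>. The line with base point \<open>x\<^sub>0\<close> and direction \<open>w\<close> shows that the first of them is
  dense in the quartic. It is also the image of an open subset of projective space, which is
  irreducible; hence the quartic is irreducible.\<close>
theorem rational_threefold_quarticI:
  fixes F :: "'k::{alg_closed_field, field_char_0} ^ 6 \<Rightarrow> 'k ^ 4" and G :: "'k ^ 4
      \<Rightarrow> 'k ^ 6"
  assumes F: "\<And>j. homogeneous_poly m (\<lambda>x. F x $ j)" "m > 0"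
    and G: "\<And>j. homogeneous_poly n (\<lambda>y. G y $ j)" "n > 0"
    and a: "homogeneous_poly da a" "da > 0" and b: "homogeneous_poly db b"
    and GF: "\<And>x. coord_sum x = 0 \<Longrightarrow> quartic_form t x = 0 \<Longrightarrow> a x
        \<noteq> 0 \<Longrightarrow> b (F x) \<noteq> 0 \<Longrightarrow>
      \<exists>c. c \<noteq> 0 \<and> G (F x) = c *s x"
    and G_in: "\<And>y. b y \<noteq> 0 \<Longrightarrow> coord_sum (G y) = 0 \<and> quartic_form t
        (G y) = 0"
    and FG: "\<And>y. b y \<noteq> 0 \<Longrightarrow> a (G y) \<noteq> 0 \<Longrightarrow>
        \<exists>c. c \<noteq> 0 \<and> F (G y) = c *s y"
    and line: "coord_sum x\<^sub>0 = 0" "coord_sum w = 0" "quartic_form t w \<noteq> 0"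
      "\<And>z. quartic_form t (x\<^sub>0 + z *s w) = 0 \<Longrightarrow> a (x\<^sub>0 + z *s w)
          \<noteq> 0 \<and> b (F (x\<^sub>0 + z *s w)) \<noteq> 0"
  shows "rational_threefold (quartic t)"
proof -
  define X where "X = (\<lambda>x :: 'k ^ 6. coord_sum x = 0 \<and> quartic_form t x = 0)"
  define h where "h = (\<lambda>x. a x * b (F x))"
  define g where "g = (\<lambda>y. b y * a (G y))"
  have h: "homogeneous_poly (da + m * db) h"
    unfolding h_def by (intro homogeneous_poly_mult homogeneous_poly_comp a(1) b F)
  have g: "homogeneous_poly (db + n * da) g"
    unfolding g_def by (intro homogeneous_poly_mult homogeneous_poly_comp a(1) b G)
  have F0: "F 0 = 0"
  proof -
    have "F 0 $ j = 0" for j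
      using homogeneous_poly_scale[OF F(1)[of j], of 0 0] F(2) by (auto simp: power_0_left)
    then show ?thesis by (simp add: vec_eq_iff)
  qed
  have G0: "G 0 = 0"
  proof -
    have "G 0 $ j = 0" for j
      using homogeneous_poly_scale[OF G(1)[of j], of 0 0] G(2) by (auto simp: power_0_left)
    then show ?thesis by (simp add: vec_eq_iff)
  qed
  have hF: "F x \<noteq> 0 \<and> g (F x) \<noteq> 0 \<and> (\<exists>c. c \<noteq> 0 \<and> G (F
      x) = c *s x)"
    if "X x" "h x \<noteq> 0" "x \<noteq> 0" for x
  proof -
    have "\<exists>c. c \<noteq> 0 \<and> G (F x) = c *s x"
      using GF[of x] that unfolding X_def h_def by auto
    then obtain c where c: "c \<noteq> 0" "G (F x) = c *s x" by auto
    then have "F x \<noteq> 0" using G0 that(3) by (auto simp: vector_mul_eq_0)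
    moreover have "a (G (F x)) \<noteq> 0"
      using c homogeneous_poly_scale[OF a(1)] that(2) unfolding h_def by simp
    ultimately show ?thesis using c that(2) unfolding g_def h_def by auto
  qed
  have gG: "X (G y) \<and> G y \<noteq> 0 \<and> h (G y) \<noteq> 0 \<and> (\<exists>c. c \<noteq>
      0 \<and> F (G y) = c *s y)"
    if "g y \<noteq> 0" "y \<noteq> 0" for y
  proof -
    have "\<exists>c. c \<noteq> 0 \<and> F (G y) = c *s y"
      using FG[of y] that unfolding g_def by auto
    then obtain c where c: "c \<noteq> 0" "F (G y) = c *s y" by auto
    then have "G y \<noteq> 0" using F0 that(2) by (auto simp: vector_mul_eq_0)
    moreover have "b (F (G y)) \<noteq> 0"
      using c homogeneous_poly_scale[OF b] that(1) unfolding g_def by simp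
    ultimately show ?thesis using c G_in that(1) unfolding g_def h_def X_def by auto
  qed
  define U where "U = quartic t - zero_locus {h}"
  define V where "V = - zero_locus {g}"
  have in_U: "proj_point x \<in> U \<longleftrightarrow> X x \<and> h x \<noteq> 0" if "x \<noteq>
      0" for x
    unfolding U_def X_def Diff_iff proj_point_in_quartic[OF that]
    using proj_point_in_zero_locus[of "{h}" x] h that by auto
  have in_V: "proj_point y \<in> V \<longleftrightarrow> g y \<noteq> 0" if "y \<noteq> 0" for y
    unfolding V_def using proj_point_in_zero_locus[of "{g}" y] g that by auto
  have U: "dense_open_in U (quartic t)"
    unfolding U_def
    by (rule dense_open_in_nonzero_quartic[OF h line(1-3)]) (use line(4) in \<open>auto simp:
        h_def\<close>)
  obtain x\<^sub>1 where x\<^sub>1: "x\<^sub>1 \<noteq> 0" "X x\<^sub>1" "h x\<^sub>1 \<noteq> 0"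
  proof -
    obtain p where p: "\<forall>s z. poly (slice s p) z = quartic_form t (x\<^sub>0 + s *s 0 + z
        *s w)"
      "degree p \<le> 4" "coeff p 4 = [:quartic_form t w:]"
      using homogeneous_poly_on_plane[OF homogeneous_poly_quartic_form, of t x\<^sub>0 0 w] by blast
    have "coeff (slice 0 p) 4 \<noteq> 0" using p(3) line(3) by simp
    then have "degree (slice 0 p) > 0" using le_degree[of "slice 0 p" 4] by linarith
    then obtain z where "poly (slice 0 p) z = 0" using alg_closed_imp_poly_has_root by blast
    then have z: "quartic_form t (x\<^sub>0 + z *s w) = 0" using p(1) by simp
    define x where "x = x\<^sub>0 + z *s w"
    have "x \<noteq> 0"
      using line(4)[OF z] homogeneous_poly_scale[OF a(1), of 0 0] a(2) unfolding x_def by (auto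
          simp: power_0_left)
    then show ?thesis
      using that[of x] line(1,2) line(4)[OF z] z unfolding X_def h_def x_def
      by (auto simp: coord_sum_add)
  qed
  have V: "dense_open_in V UNIV"
    unfolding V_def by (rule dense_open_in_nonzero_UNIV[OF g, of "F x\<^sub>1"]) (use hF x\<^sub>1
        in blast)
  obtain \<phi> where \<phi>: "regular_map_on U \<phi>"
    "\<And>x. x \<noteq> 0 \<Longrightarrow> proj_point x \<in> U \<Longrightarrow> \<phi>
        (proj_point x) = proj_point (F x)"
    using regular_map_on_form_map[OF F(1), where U = U] in_U hF by metis
  obtain \<psi> where \<psi>: "regular_map_on V \<psi>"
    "\<And>y. y \<noteq> 0 \<Longrightarrow> proj_point y \<in> V \<Longrightarrow> \<psi>
        (proj_point y) = proj_point (G y)"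
    using regular_map_on_form_map[OF G(1), where U = V] in_V gG by metis
  have UV: "\<phi> p \<in> V \<and> \<psi> (\<phi> p) = p" if "p \<in> U" for p
  proof -
    obtain x where x: "x \<noteq> 0" "p = proj_point x" by (rule proj_point_cases)
    then have Xx: "X x" "h x \<noteq> 0" using in_U that by auto
    note Fx = hF[OF Xx x(1)]
    then have \<phi>p: "\<phi> p = proj_point (F x)" "\<phi> p \<in> V" using \<phi>(2) x that
        in_V by auto
    then have "\<psi> (\<phi> p) = proj_point (G (F x))" using \<psi>(2) Fx by auto
    moreover obtain c where "c \<noteq> 0" "G (F x) = c *s x"
      using Fx by auto
    moreover have "proj_point x = proj_point (c *s x)"
      using \<open>c \<noteq> 0\<close> x(1) by (subst proj_point_eq_iff) (auto simp:
          vector_mul_eq_0)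
    ultimately show ?thesis using \<phi>p x(2) by simp
  qed
  have VU: "\<psi> q \<in> U \<and> \<phi> (\<psi> q) = q" if "q \<in> V" for q
  proof -
    obtain y where y: "y \<noteq> 0" "q = proj_point y" by (rule proj_point_cases)
    then have gy: "g y \<noteq> 0" using in_V that by auto
    note Gy = gG[OF gy y(1)]
    then have \<psi>q: "\<psi> q = proj_point (G y)" "\<psi> q \<in> U" using \<psi>(2) y that
        in_U by auto
    then have "\<phi> (\<psi> q) = proj_point (F (G y))" using \<phi>(2) Gy by auto
    moreover obtain c where "c \<noteq> 0" "F (G y) = c *s y" using Gy by auto
    moreover have "proj_point y = proj_point (c *s y)"
      using \<open>c \<noteq> 0\<close> y(1) by (subst proj_point_eq_iff) (auto simp:
          vector_mul_eq_0)
    ultimately show ?thesis using \<psi>q y(2) by simp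
  qed
  have "birational (quartic t) (UNIV :: ('k, 4) proj set)"
    unfolding birational_def
    by (intro exI[of _ U] exI[of _ V] exI[of _ \<phi>] exI[of _ \<psi>])
      (use U V \<phi>(1) \<psi>(1) UV VU in auto)
  moreover have "closedin zariski (quartic t)"
    unfolding closedin_zariski zariski_closed_def quartic_eq_zero_locus
    by (intro exI[of _ "{coord_sum, quartic_form t}"])
      (use homogeneous_poly_coord_sum homogeneous_poly_quartic_form in auto)
  moreover have "zariski_irreducible (quartic t)"
    unfolding zariski_irreducible_def
  proof (intro conjI allI impI)
    show "quartic t \<noteq> {}"
      using proj_point_in_quartic[OF x\<^sub>1(1)] x\<^sub>1(2) unfolding X_def by blast
    fix A B :: "('k, 6) proj set"
    assume AB: "closedin zariski A \<and> closedin zariski B \<and> quartic t \<subseteq> A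
        \<union> B"
    have U_sub: "quartic t \<subseteq> C" if "closedin zariski C" "U \<subseteq> C" for C
      using U that closure_of_minimal unfolding dense_open_in_def by blast
    have "U \<subseteq> A \<or> U \<subseteq> B"
    proof (rule ccontr)
      assume "\<not> ?thesis"
      then obtain p q where pq: "p \<in> U" "p \<notin> A" "q \<in> U" "q \<notin> B" by blast
      have pull: "\<exists>f d y. homogeneous_poly d f \<and> f y \<noteq> 0 \<and>
          (\<forall>y. y \<noteq> 0 \<longrightarrow> g y \<noteq> 0 \<longrightarrow> f y
              \<noteq> 0 \<longrightarrow> proj_point (G y) \<notin> C)"
        if C: "closedin zariski C" "p \<in> U" "p \<notin> C" for p C
      proof -
        obtain x where x: "x \<noteq> 0" "p = proj_point x" by (rule proj_point_cases)
        have "openin zariski (- C)" using C(1) unfolding closedin_def by (simp add: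
            Compl_eq_Diff_UNIV)
        moreover have "proj_point x \<in> - C" using x(2) C(3) by simp
        ultimately obtain f d where f: "homogeneous_poly d f" "f x \<noteq> 0"
          "\<And>x. x \<noteq> 0 \<Longrightarrow> f x \<noteq> 0 \<Longrightarrow> proj_point x
              \<in> - C"
          using x(1) zariski_open_avoids_form by metis
        have "X x" "h x \<noteq> 0" using in_U[OF x(1)] C(2) x(2) by auto
        from hF[OF this x(1)] obtain c where "c \<noteq> 0" "G (F x) = c *s x" by auto
        then have "f (G (F x)) \<noteq> 0" using f(2) homogeneous_poly_scale[OF f(1)] by simp
        moreover have "homogeneous_poly (n * d) (\<lambda>y. f (G y))"
          by (intro homogeneous_poly_comp f G)
        ultimately show ?thesis using f(3) gG by (intro exI[of _ "\<lambda>y. f (G y)"]) blast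
      qed
      from pull[OF AB[THEN conjunct1] pq(1,2)]
      obtain f d y where f: "homogeneous_poly d f" "f y \<noteq> 0"
        "\<forall>y. y \<noteq> 0 \<longrightarrow> g y \<noteq> 0 \<longrightarrow> f y \<noteq>
            0 \<longrightarrow> proj_point (G y) \<notin> A"
        by (elim exE conjE) (rule that)
      from pull[OF AB[THEN conjunct2, THEN conjunct1] pq(3,4)]
      obtain f' d' y' where f': "homogeneous_poly d' f'" "f' y' \<noteq> 0"
        "\<forall>y. y \<noteq> 0 \<longrightarrow> g y \<noteq> 0 \<longrightarrow> f' y \<noteq>
            0 \<longrightarrow> proj_point (G y) \<notin> B"
        by (elim exE conjE) (rule that)
      obtain y1 where y1: "f y1 \<noteq> 0" "f' y1 \<noteq> 0"
        using common_nonzero[OF f(1) f'(1) f(2) f'(2)] .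
      obtain j where j: "F x\<^sub>1 $ j \<noteq> 0" using hF x\<^sub>1 by (auto simp: vec_eq_iff)
      \<comment> \<open>The factor \<open>y $ j\<close> keeps the point away from the origin.\<close>
      obtain y2 where y2: "f y2 * f' y2 \<noteq> 0" "g y2 * y2 $ j \<noteq> 0"
        using common_nonzero[OF homogeneous_poly_mult[OF f(1) f'(1)]
            homogeneous_poly_mult[OF g homogeneous_poly_coord[of j]], of y1 "F x\<^sub>1"]
          y1 hF x\<^sub>1 j by auto
      then have "y2 \<noteq> 0" by auto
      then have "proj_point (G y2) \<in> quartic t"
        using gG[of y2] y2 in_U unfolding U_def by auto
      then show False using AB f(3) f'(3) y2 \<open>y2 \<noteq> 0\<close> by auto
    qed
    then show "quartic t \<subseteq> A \<or> quartic t \<subseteq> B" using U_sub AB by blast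
  qed
  ultimately show ?thesis
    unfolding rational_threefold_def projective_variety_def by blast
qed

section \<open>Linear and bilinear forms\<close>

definition linear_form :: "('k::field ^ 'n \<Rightarrow> 'k) \<Rightarrow> bool" where
  "linear_form c \<longleftrightarrow> (\<exists>a. \<forall>x. c x = (\<Sum>i\<in>UNIV. a i * x $
      i))"

definition bilinear_form :: "('k::field ^ 'n \<Rightarrow> 'k ^ 'n \<Rightarrow> 'k) \<Rightarrow>
    bool" where
  "bilinear_form B \<longleftrightarrow> (\<exists>A. \<forall>x y. B x y = (\<Sum>i\<in>UNIV.
      \<Sum>j\<in>UNIV. A i j * (x $ i * y $ j)))"

named_theorems form_intros

lemma linear_form_coord [form_intros]: "linear_form (\<lambda>x :: 'k::field ^ 'n. x $ i)"
proof -
  have "x $ i = (\<Sum>j\<in>UNIV. (if j = i then 1 else 0) * x $ j)" for x :: "'k ^ 'n"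
    by (simp add: if_distrib[of "\<lambda>a. a * _"] cong: if_cong)
  then show ?thesis unfolding linear_form_def by metis
qed

lemma linear_form_add [form_intros]:
  assumes "linear_form c" "linear_form d"
  shows "linear_form (\<lambda>x. c x + d x)"
proof -
  obtain a b where "\<forall>x. c x = (\<Sum>i\<in>UNIV. a i * x $ i)" "\<forall>x. d x =
      (\<Sum>i\<in>UNIV. b i * x $ i)"
    using assms unfolding linear_form_def by metis
  then show ?thesis
    unfolding linear_form_def
    by (intro exI[of _ "\<lambda>i. a i + b i"]) (simp add: sum.distrib algebra_simps)
qed

lemma linear_form_cmult [form_intros]:
  assumes "linear_form c"
  shows "linear_form (\<lambda>x. k * c x)"
proof -
  obtain a where "\<forall>x. c x = (\<Sum>i\<in>UNIV. a i * x $ i)"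
    using assms unfolding linear_form_def by metis
  then show ?thesis
    unfolding linear_form_def
    by (intro exI[of _ "\<lambda>i. k * a i"]) (simp add: sum_distrib_left algebra_simps)
qed

lemma linear_form_diff [form_intros]:
  assumes "linear_form c" "linear_form d"
  shows "linear_form (\<lambda>x. c x - d x)"
  using linear_form_add[OF assms(1) linear_form_cmult[OF assms(2), of "-1"]] by simp

lemma linear_form_minus [form_intros]:
  assumes "linear_form c"
  shows "linear_form (\<lambda>x. - c x)"
  using linear_form_cmult[OF assms, of "-1"] by simp

lemma linear_form_divide [form_intros]:
  assumes "linear_form c"
  shows "linear_form (\<lambda>x. c x / k)"
  using linear_form_cmult[OF assms, of "inverse k"] by (simp add: field_simps)

lemma bilinear_form_mult [form_intros]:
  assumes "linear_form c" "linear_form d"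
  shows "bilinear_form (\<lambda>x y. c x * d y)"
proof -
  obtain a b where "\<forall>x. c x = (\<Sum>i\<in>UNIV. a i * x $ i)" "\<forall>x. d x =
      (\<Sum>i\<in>UNIV. b i * x $ i)"
    using assms unfolding linear_form_def by metis
  then show ?thesis
    unfolding bilinear_form_def
    by (intro exI[of _ "\<lambda>i j. a i * b j"]) (simp add: sum_product algebra_simps)
qed

lemma bilinear_form_add [form_intros]:
  assumes "bilinear_form B" "bilinear_form C"
  shows "bilinear_form (\<lambda>x y. B x y + C x y)"
proof -
  obtain a where "\<forall>x y. B x y = (\<Sum>i\<in>UNIV. \<Sum>j\<in>UNIV. a i j * (x $ i * y $
      j))"
    using assms(1) unfolding bilinear_form_def by blast
  moreover obtain b where "\<forall>x y. C x y = (\<Sum>i\<in>UNIV. \<Sum>j\<in>UNIV. b i j * (x $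
      i * y $ j))"
    using assms(2) unfolding bilinear_form_def by blast
  ultimately show ?thesis
    unfolding bilinear_form_def
    by (intro exI[of _ "\<lambda>i j. a i j + b i j"]) (simp add: sum.distrib distrib_right)
qed

lemma bilinear_form_cmult [form_intros]:
  assumes "bilinear_form B"
  shows "bilinear_form (\<lambda>x y. k * B x y)"
proof -
  obtain a where "\<forall>x y. B x y = (\<Sum>i\<in>UNIV. \<Sum>j\<in>UNIV. a i j * (x $ i * y $
      j))"
    using assms unfolding bilinear_form_def by blast
  then show ?thesis
    unfolding bilinear_form_def
    by (intro exI[of _ "\<lambda>i j. k * a i j"]) (simp add: sum_distrib_left mult.assoc)
qed

lemma bilinear_form_diff [form_intros]:
  assumes "bilinear_form B" "bilinear_form C"
  shows "bilinear_form (\<lambda>x y. B x y - C x y)"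
  using bilinear_form_add[OF assms(1) bilinear_form_cmult[OF assms(2), of "-1"]] by simp

lemma linear_form_homogeneous:
  assumes "linear_form c" "\<And>i. homogeneous_poly d (\<lambda>y. u y $ i)"
  shows "homogeneous_poly d (\<lambda>y. c (u y))"
proof -
  obtain a where a: "\<And>x. c x = (\<Sum>i\<in>UNIV. a i * x $ i)"
    using assms(1) unfolding linear_form_def by metis
  show ?thesis unfolding a by (intro homogeneous_poly_sum homogeneous_poly_cmult assms(2))
qed

lemma bilinear_form_homogeneous:
  assumes "bilinear_form B" "\<And>i. homogeneous_poly d (\<lambda>y. u y $ i)"
    "\<And>i. homogeneous_poly e (\<lambda>y. v y $ i)"
  shows "homogeneous_poly (d + e) (\<lambda>y. B (u y) (v y))"
proof -
  obtain a where a: "\<And>x y. B x y = (\<Sum>i\<in>UNIV. \<Sum>j\<in>UNIV. a i j * (x $ i * y $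
      j))"
    using assms(1) unfolding bilinear_form_def by blast
  show ?thesis
    unfolding a
    by (intro homogeneous_poly_sum homogeneous_poly_cmult homogeneous_poly_mult assms(2,3))
qed

lemma bilinear_form_simps:
  assumes "bilinear_form B"
  shows "B (x + y) z = B x z + B y z" "B z (x + y) = B z x + B z y"
    "B (c *s x) z = c * B x z" "B z (c *s x) = c * B z x"
proof -
  obtain a where a: "\<And>x y. B x y = (\<Sum>i\<in>UNIV. \<Sum>j\<in>UNIV. a i j * (x $ i * y $
      j))"
    using assms unfolding bilinear_form_def by blast
  show "B (x + y) z = B x z + B y z" "B z (x + y) = B z x + B z y"
    "B (c *s x) z = c * B x z" "B z (c *s x) = c * B z x"
    unfolding a by (simp_all add: sum.distrib sum_distrib_left algebra_simps)
qed

section \<open>Fibrations whose fibres contain a line\<close>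

text \<open>The vectors \<open>e\<^sub>0, \<dots>, e\<^sub>4\<close> are a basis of the hyperplane \<open>coord_sum x = 0\<close> with coordinates
  \<open>c\<^sub>0, \<dots>, c\<^sub>4\<close>. Quadratic forms are given as values \<open>B x x\<close> of bilinear forms, which need not be
  symmetric. The line \<open>\<ell>\<^sub>\<kappa>\<close> with \<open>\<kappa> = y\<^sub>2 / y\<^sub>1\<close> is spanned by \<open>\<kappa> e\<^sub>1 + e\<^sub>2\<close> and \<open>\<delta> \<kappa> e\<^sub>3 + e\<^sub>4\<close>.
  For \<open>\<delta> = 1\<close> these lines are a ruling of the quadric surface \<open>c\<^sub>0 = 0\<close>, \<open>c\<^sub>1 c\<^sub>4 = c\<^sub>2 c\<^sub>3\<close>; for
  \<open>\<delta> = 0\<close> they are the lines through \<open>e\<^sub>4\<close> in the plane \<open>c\<^sub>0 = c\<^sub>3 = 0\<close>.\<close>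
locale line_pencil =
  fixes B\<^sub>1 B\<^sub>2 B\<^sub>3 B\<^sub>4 :: "'k::{alg_closed_field, field_char_0} ^ 6
      \<Rightarrow> 'k ^ 6 \<Rightarrow> 'k"
    and c\<^sub>0 c\<^sub>1 c\<^sub>2 c\<^sub>3 c\<^sub>4 :: "'k ^ 6 \<Rightarrow> 'k"
    and e\<^sub>0 e\<^sub>1 e\<^sub>2 e\<^sub>3 e\<^sub>4 :: "'k ^ 6"
    and \<delta> k t :: 'k
  assumes bilinear: "bilinear_form B\<^sub>1" "bilinear_form B\<^sub>2" "bilinear_form B\<^sub>3"
      "bilinear_form B\<^sub>4"
    and linear: "linear_form c\<^sub>0" "linear_form c\<^sub>1" "linear_form c\<^sub>2"
        "linear_form c\<^sub>3" "linear_form c\<^sub>4"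
    and basis_sum: "coord_sum e\<^sub>0 = 0" "coord_sum e\<^sub>1 = 0" "coord_sum e\<^sub>2 = 0"
        "coord_sum e\<^sub>3 = 0"
      "coord_sum e\<^sub>4 = 0"
    and span: "\<And>x. coord_sum x = 0 \<Longrightarrow>
      x = c\<^sub>0 x *s e\<^sub>0 + c\<^sub>1 x *s e\<^sub>1 + c\<^sub>2 x *s e\<^sub>2 +
          c\<^sub>3 x *s e\<^sub>3 + c\<^sub>4 x *s e\<^sub>4"
    and dual: "\<And>r\<^sub>0 r\<^sub>1 r\<^sub>2 r\<^sub>3 r\<^sub>4 x. x = r\<^sub>0 *s
        e\<^sub>0 + r\<^sub>1 *s e\<^sub>1 + r\<^sub>2 *s e\<^sub>2 + r\<^sub>3 *s e\<^sub>3 +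
        r\<^sub>4 *s e\<^sub>4 \<Longrightarrow>
      c\<^sub>0 x = r\<^sub>0 \<and> c\<^sub>1 x = r\<^sub>1 \<and> c\<^sub>2 x = r\<^sub>2 \<and>
          c\<^sub>3 x = r\<^sub>3 \<and> c\<^sub>4 x = r\<^sub>4"
    and on_line: "\<And>y\<^sub>1 y\<^sub>2 m l x.
      x = m *s (y\<^sub>2 *s e\<^sub>1 + y\<^sub>1 *s e\<^sub>2) + l *s ((\<delta> * y\<^sub>2) *s
          e\<^sub>3 + y\<^sub>1 *s e\<^sub>4) \<Longrightarrow>
      y\<^sub>1 * B\<^sub>1 x x = y\<^sub>2 * B\<^sub>2 x x \<and> y\<^sub>1 * B\<^sub>3 x x =
          y\<^sub>2 * B\<^sub>4 x x"
    and quartic_form: "\<And>x. coord_sum x = 0 \<Longrightarrow>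
      quartic_form t x = k * (B\<^sub>1 x x * B\<^sub>4 x x - B\<^sub>2 x x * B\<^sub>3 x x)"
begin

text \<open>The linear forms \<open>c\<^sub>0\<close>, \<open>c\<^sub>1 - \<kappa> c\<^sub>2\<close> and \<open>c\<^sub>3 - \<delta> \<kappa> c\<^sub>4\<close> cut out \<open>\<ell>\<^sub>\<kappa>\<close>. Their values at \<open>x\<close>
  describe the plane through \<open>\<ell>\<^sub>\<kappa>\<close> and \<open>x\<close>. In the affine chart in which the first coordinate is
  \<open>1\<close>, the point \<open>to_space x\<close> has coordinates \<open>\<kappa>\<close>, \<open>(c\<^sub>1 - \<kappa> c\<^sub>2) / c\<^sub>0\<close> and \<open>(c\<^sub>3 - \<delta> \<kappa> c\<^sub>4) /
  c\<^sub>0\<close>.\<close>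
definition to_space :: "'k ^ 6 \<Rightarrow> 'k ^ 4" where
  "to_space x = vector [c\<^sub>0 x * B\<^sub>2 x x, c\<^sub>0 x * B\<^sub>1 x x, c\<^sub>1 x *
      B\<^sub>2 x x - c\<^sub>2 x * B\<^sub>1 x x,
    c\<^sub>3 x * B\<^sub>2 x x - \<delta> * c\<^sub>4 x * B\<^sub>1 x x]"

text \<open>The plane that belongs to \<open>y\<close> is spanned by the line \<open>\<ell>\<^sub>\<kappa>\<close> through \<open>line_pt y\<close> and \<open>line_pt'
  y\<close>, and by the point \<open>off_line y\<close>.\<close>
definition off_line :: "'k ^ 4 \<Rightarrow> 'k ^ 6" where
  "off_line y = y $ 1 *s e\<^sub>0 + y $ 3 *s e\<^sub>1 + y $ 4 *s e\<^sub>3"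

definition line_pt :: "'k ^ 4 \<Rightarrow> 'k ^ 6" where
  "line_pt y = y $ 2 *s e\<^sub>1 + y $ 1 *s e\<^sub>2"

definition line_pt' :: "'k ^ 4 \<Rightarrow> 'k ^ 6" where
  "line_pt' y = (\<delta> * y $ 2) *s e\<^sub>3 + y $ 1 *s e\<^sub>4"

text \<open>The bilinear forms of the two quadrics that cut out the fibre over \<open>\<kappa>\<close>.\<close>
definition fibre_form :: "'k ^ 4 \<Rightarrow> 'k ^ 6 \<Rightarrow> 'k ^ 6 \<Rightarrow> 'k" where
  "fibre_form y u v = y $ 1 * B\<^sub>1 u v - y $ 2 * B\<^sub>2 u v"

definition fibre_form' :: "'k ^ 4 \<Rightarrow> 'k ^ 6 \<Rightarrow> 'k ^ 6 \<Rightarrow> 'k" where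
  "fibre_form' y u v = y $ 1 * B\<^sub>3 u v - y $ 2 * B\<^sub>4 u v"

text \<open>On the plane that belongs to \<open>y\<close>, with coordinates \<open>(r, m, l)\<close>, a quadric containing \<open>\<ell>\<^sub>\<kappa>\<close>
  has the equation \<open>r (coeff\<^sub>0 r + coeff\<^sub>1 m + coeff\<^sub>2 l) = 0\<close>.\<close>
definition coeff\<^sub>0 :: "('k ^ 4 \<Rightarrow> 'k ^ 6 \<Rightarrow> 'k ^ 6 \<Rightarrow> 'k)
    \<Rightarrow> 'k ^ 4 \<Rightarrow> 'k" where
  "coeff\<^sub>0 f y = f y (off_line y) (off_line y)"

definition coeff\<^sub>1 :: "('k ^ 4 \<Rightarrow> 'k ^ 6 \<Rightarrow> 'k ^ 6 \<Rightarrow> 'k)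
    \<Rightarrow> 'k ^ 4 \<Rightarrow> 'k" where
  "coeff\<^sub>1 f y = f y (off_line y) (line_pt y) + f y (line_pt y) (off_line y)"

definition coeff\<^sub>2 :: "('k ^ 4 \<Rightarrow> 'k ^ 6 \<Rightarrow> 'k ^ 6 \<Rightarrow> 'k)
    \<Rightarrow> 'k ^ 4 \<Rightarrow> 'k" where
  "coeff\<^sub>2 f y = f y (off_line y) (line_pt' y) + f y (line_pt' y) (off_line y)"

text \<open>\<open>(r\<^sub>0, r\<^sub>1, r\<^sub>2)\<close> is the cross product of the coefficient vectors of the two residual lines,
  that is, their point of intersection.\<close>
definition r\<^sub>0 :: "'k ^ 4 \<Rightarrow> 'k" where
  "r\<^sub>0 y = coeff\<^sub>1 fibre_form y * coeff\<^sub>2 fibre_form' y - coeff\<^sub>2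
      fibre_form y * coeff\<^sub>1 fibre_form' y"

definition r\<^sub>1 :: "'k ^ 4 \<Rightarrow> 'k" where
  "r\<^sub>1 y = coeff\<^sub>2 fibre_form y * coeff\<^sub>0 fibre_form' y - coeff\<^sub>0
      fibre_form y * coeff\<^sub>2 fibre_form' y"

definition r\<^sub>2 :: "'k ^ 4 \<Rightarrow> 'k" where
  "r\<^sub>2 y = coeff\<^sub>0 fibre_form y * coeff\<^sub>1 fibre_form' y - coeff\<^sub>1
      fibre_form y * coeff\<^sub>0 fibre_form' y"

definition from_space :: "'k ^ 4 \<Rightarrow> 'k ^ 6" where
  "from_space y = r\<^sub>0 y *s off_line y + r\<^sub>1 y *s line_pt y + r\<^sub>2 y *s line_pt' y"

text \<open>The forms \<open>polar x\<close> and \<open>polar' x\<close> define the tangent spaces at \<open>x\<close> of the two quadrics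
  through \<open>x\<close>, up to scalars. So \<open>transversal x \<noteq> 0\<close> says that the two residual lines in the plane
  through \<open>x\<close> and \<open>\<ell>\<^sub>\<kappa>\<close> are distinct. This is easier to evaluate than \<open>r\<^sub>0 (to_space x)\<close>.\<close>
definition line_dir :: "'k ^ 6 \<Rightarrow> 'k ^ 6" where
  "line_dir x = B\<^sub>1 x x *s e\<^sub>1 + B\<^sub>2 x x *s e\<^sub>2"

definition line_dir' :: "'k ^ 6 \<Rightarrow> 'k ^ 6" where
  "line_dir' x = (\<delta> * B\<^sub>1 x x) *s e\<^sub>3 + B\<^sub>2 x x *s e\<^sub>4"

definition polar :: "'k ^ 6 \<Rightarrow> 'k ^ 6 \<Rightarrow> 'k" where
  "polar x v = B\<^sub>2 x x * (B\<^sub>1 x v + B\<^sub>1 v x) - B\<^sub>1 x x * (B\<^sub>2 x v +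
      B\<^sub>2 v x)"

definition polar' :: "'k ^ 6 \<Rightarrow> 'k ^ 6 \<Rightarrow> 'k" where
  "polar' x v = B\<^sub>2 x x * (B\<^sub>3 x v + B\<^sub>3 v x) - B\<^sub>1 x x * (B\<^sub>4 x v +
      B\<^sub>4 v x)"

definition transversal :: "'k ^ 6 \<Rightarrow> 'k" where
  "transversal x = polar x (line_dir x) * polar' x (line_dir' x)
     - polar x (line_dir' x) * polar' x (line_dir x)"

lemma bilinear_fibre_form: "bilinear_form (fibre_form y)" "bilinear_form (fibre_form' y)"
  unfolding fibre_form_def[abs_def] fibre_form'_def[abs_def]
  by (intro bilinear_form_diff bilinear_form_cmult bilinear)+

lemma fibre_form_on_line:
  "fibre_form y (m *s line_pt y + l *s line_pt' y) (m *s line_pt y + l *s line_pt' y) = 0"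
  "fibre_form' y (m *s line_pt y + l *s line_pt' y) (m *s line_pt y + l *s line_pt' y) = 0"
  using on_line[OF refl, of "y $ 1" m "y $ 2" l]
  unfolding fibre_form_def fibre_form'_def line_pt_def line_pt'_def by simp_all

lemma quadratic_near_line:
  fixes f :: "'k ^ 6 \<Rightarrow> 'k ^ 6 \<Rightarrow> 'k"
  assumes "bilinear_form f" "f (m *s p + l *s q) (m *s p + l *s q) = 0"
    and x: "x = r *s u + m *s p + l *s q"
  shows "f x x = r * (r * f u u + m * (f u p + f p u) + l * (f u q + f q u))"
proof -
  define v where "v = m *s p + l *s q"
  have "x = r *s u + v" unfolding x v_def by (simp add: add.assoc)
  then have "f x x = r * r * f u u + r * (f u v + f v u) + f v v"
    by (simp add: bilinear_form_simps[OF assms(1)] algebra_simps)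
  also have "f v v = 0" using assms(2) unfolding v_def .
  finally show ?thesis
    unfolding v_def by (simp add: bilinear_form_simps[OF assms(1)] algebra_simps)
qed

lemma fibre_form_expand:
  assumes "x = r *s off_line y + m *s line_pt y + l *s line_pt' y"
  shows "fibre_form y x x = r * (r * coeff\<^sub>0 fibre_form y + m * coeff\<^sub>1 fibre_form y +
      l * coeff\<^sub>2 fibre_form y)"
    "fibre_form' y x x = r * (r * coeff\<^sub>0 fibre_form' y + m * coeff\<^sub>1 fibre_form' y +
        l * coeff\<^sub>2 fibre_form' y)"
  using quadratic_near_line[OF bilinear_fibre_form(1) fibre_form_on_line(1) assms]
    quadratic_near_line[OF bilinear_fibre_form(2) fibre_form_on_line(2) assms]
  unfolding coeff\<^sub>0_def coeff\<^sub>1_def coeff\<^sub>2_def by auto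

lemma to_space_nth:
  "to_space x $ 1 = c\<^sub>0 x * B\<^sub>2 x x" "to_space x $ 2 = c\<^sub>0 x * B\<^sub>1 x x"
  "to_space x $ 3 = c\<^sub>1 x * B\<^sub>2 x x - c\<^sub>2 x * B\<^sub>1 x x"
  "to_space x $ 4 = c\<^sub>3 x * B\<^sub>2 x x - \<delta> * c\<^sub>4 x * B\<^sub>1 x x"
  unfolding to_space_def by (simp_all add: vector_def)

lemma reconstruct:
  assumes "coord_sum x = 0"
  shows "(c\<^sub>0 x * B\<^sub>2 x x) *s x = c\<^sub>0 x *s off_line (to_space x) + c\<^sub>2 x
      *s line_pt (to_space x)
    + c\<^sub>4 x *s line_pt' (to_space x)"
proof -
  define b where "b = B\<^sub>2 x x"
  have "(c\<^sub>0 x * b) *s x = (c\<^sub>0 x * b) *s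
      (c\<^sub>0 x *s e\<^sub>0 + c\<^sub>1 x *s e\<^sub>1 + c\<^sub>2 x *s e\<^sub>2 + c\<^sub>3
          x *s e\<^sub>3 + c\<^sub>4 x *s e\<^sub>4)"
    using span[OF assms] by simp
  then show ?thesis
    unfolding off_line_def line_pt_def line_pt'_def to_space_nth b_def[symmetric]
    by (simp add: vec_eq_iff algebra_simps)
qed

lemma fibre_contains:
  assumes "coord_sum x = 0" "quartic_form t x = 0" "k \<noteq> 0"
  shows "fibre_form (to_space x) x x = 0" "fibre_form' (to_space x) x x = 0"
  using quartic_form[OF assms(1)] assms(2,3)
  unfolding fibre_form_def fibre_form'_def to_space_nth by (auto simp: algebra_simps)

text \<open>The coordinates \<open>(c\<^sub>0 x, c\<^sub>2 x, c\<^sub>4 x)\<close> of \<open>x\<close> in its plane solve the two linear equations,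
  so they are proportional to the cross product.\<close>
lemma from_to_space:
  assumes x: "coord_sum x = 0" "quartic_form t x = 0" "k \<noteq> 0" and nz: "c\<^sub>0 x *
      B\<^sub>2 x x \<noteq> 0"
  shows "from_space (to_space x) = (r\<^sub>0 (to_space x) * B\<^sub>2 x x) *s x"
proof -
  define y where "y = to_space x"
  define s where "s = c\<^sub>0 x * B\<^sub>2 x x"
  have sx: "s *s x = c\<^sub>0 x *s off_line y + c\<^sub>2 x *s line_pt y + c\<^sub>4 x *s
      line_pt' y"
    unfolding s_def y_def by (rule reconstruct[OF x(1)])
  have "fibre_form y (s *s x) (s *s x) = 0" "fibre_form' y (s *s x) (s *s x) = 0"
    using fibre_contains[OF x] unfolding y_def
    by (simp_all add: bilinear_form_simps[OF bilinear_fibre_form(1)] bilinear_form_simps[OF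
        bilinear_fibre_form(2)])
  then have eqs:
    "c\<^sub>0 x * coeff\<^sub>0 fibre_form y + c\<^sub>2 x * coeff\<^sub>1 fibre_form y +
        c\<^sub>4 x * coeff\<^sub>2 fibre_form y = 0"
    "c\<^sub>0 x * coeff\<^sub>0 fibre_form' y + c\<^sub>2 x * coeff\<^sub>1 fibre_form' y +
        c\<^sub>4 x * coeff\<^sub>2 fibre_form' y = 0"
    using fibre_form_expand[OF sx] nz by auto
  have "c\<^sub>0 x * r\<^sub>1 y = c\<^sub>2 x * r\<^sub>0 y"
    unfolding r\<^sub>0_def r\<^sub>1_def using eqs by algebra
  moreover have "c\<^sub>0 x * r\<^sub>2 y = c\<^sub>4 x * r\<^sub>0 y"
    unfolding r\<^sub>0_def r\<^sub>2_def using eqs by algebra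
  moreover have "c\<^sub>0 x *s from_space y = (c\<^sub>0 x * r\<^sub>0 y) *s off_line y +
      (c\<^sub>0 x * r\<^sub>1 y) *s line_pt y
      + (c\<^sub>0 x * r\<^sub>2 y) *s line_pt' y"
    unfolding from_space_def by (simp add: vec_eq_iff algebra_simps)
  ultimately have "c\<^sub>0 x *s from_space y = r\<^sub>0 y *s (s *s x)"
    unfolding sx by (simp add: vec_eq_iff algebra_simps)
  then have "c\<^sub>0 x *s from_space y = c\<^sub>0 x *s ((r\<^sub>0 y * B\<^sub>2 x x) *s x)"
    unfolding s_def by (simp add: vec_eq_iff algebra_simps)
  moreover have "c\<^sub>0 x \<noteq> 0" using nz by simp
  ultimately show ?thesis
    unfolding y_def vec_eq_iff vector_smult_component mult_cancel_left by blast
qed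

lemma from_space_fibre:
  "fibre_form y (from_space y) (from_space y) = 0" "fibre_form' y (from_space y) (from_space y) = 0"
  using fibre_form_expand[of "from_space y" "r\<^sub>0 y" y "r\<^sub>1 y" "r\<^sub>2 y"]
  unfolding from_space_def r\<^sub>0_def r\<^sub>1_def r\<^sub>2_def by (auto simp: algebra_simps)

lemma from_space_basis:
  "from_space y = (y $ 1 * r\<^sub>0 y) *s e\<^sub>0 + (y $ 3 * r\<^sub>0 y + y $ 2 * r\<^sub>1 y)
      *s e\<^sub>1 + (y $ 1 * r\<^sub>1 y) *s e\<^sub>2
    + (y $ 4 * r\<^sub>0 y + \<delta> * y $ 2 * r\<^sub>2 y) *s e\<^sub>3 + (y $ 1 * r\<^sub>2 y)
        *s e\<^sub>4"
  unfolding from_space_def off_line_def line_pt_def line_pt'_def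
  by (simp add: vec_eq_iff algebra_simps)

lemma from_space_in_quartic:
  assumes "y $ 1 \<noteq> 0"
  shows "coord_sum (from_space y) = 0" "quartic_form t (from_space y) = 0"
proof -
  show sum: "coord_sum (from_space y) = 0"
    unfolding from_space_basis by (simp add: coord_sum_plus coord_sum_scale basis_sum)
  define x where "x = from_space y"
  have "y $ 1 * (B\<^sub>1 x x * B\<^sub>4 x x - B\<^sub>2 x x * B\<^sub>3 x x) = 0"
    using from_space_fibre[of y] unfolding fibre_form_def fibre_form'_def x_def[symmetric] by
        algebra
  then show "quartic_form t (from_space y) = 0"
    using quartic_form[OF sum] assms unfolding x_def by auto
qed

lemma to_from_space:
  assumes "y $ 1 \<noteq> 0"
  shows "to_space (from_space y) = (r\<^sub>0 y * B\<^sub>2 (from_space y) (from_space y)) *s y"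
proof -
  define x where "x = from_space y"
  note c = dual[OF from_space_basis[of y], folded x_def]
  have Q: "y $ 1 * B\<^sub>1 x x = y $ 2 * B\<^sub>2 x x"
    using from_space_fibre(1)[of y] unfolding fibre_form_def x_def by simp
  have "to_space x $ i = ((r\<^sub>0 y * B\<^sub>2 x x) *s y) $ i" for i
  proof -
    have "to_space x $ 1 = r\<^sub>0 y * B\<^sub>2 x x * y $ 1" unfolding to_space_nth using c by
        simp
    moreover have "to_space x $ 2 = r\<^sub>0 y * B\<^sub>2 x x * y $ 2"
      unfolding to_space_nth using c Q by (metis mult.assoc mult.commute)
    moreover have "to_space x $ 3 = r\<^sub>0 y * B\<^sub>2 x x * y $ 3"
    proof -
      have "to_space x $ 3 = (y $ 3 * r\<^sub>0 y + y $ 2 * r\<^sub>1 y) * B\<^sub>2 x x - y $ 1 *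
          r\<^sub>1 y * B\<^sub>1 x x"
        unfolding to_space_nth using c by simp
      then show ?thesis using Q by algebra
    qed
    moreover have "to_space x $ 4 = r\<^sub>0 y * B\<^sub>2 x x * y $ 4"
    proof -
      have "to_space x $ 4 = (y $ 4 * r\<^sub>0 y + \<delta> * y $ 2 * r\<^sub>2 y) * B\<^sub>2 x
          x - \<delta> * (y $ 1 * r\<^sub>2 y) * B\<^sub>1 x x"
        unfolding to_space_nth using c by simp
      then show ?thesis using Q by algebra
    qed
    ultimately show ?thesis using exhaust_4[of i] by auto
  qed
  then show ?thesis unfolding x_def by (simp add: vec_eq_iff)
qed

text \<open>Modulo \<open>\<ell>\<^sub>\<kappa>\<close>, the points \<open>off_line (to_space x)\<close> and \<open>B\<^sub>2 x x *s x\<close> agree. The difference is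
  invisible to the symmetrised pairing with points of \<open>\<ell>\<^sub>\<kappa>\<close>, because the quadrics contain \<open>\<ell>\<^sub>\<kappa>\<close>.\<close>
lemma r\<^sub>0_to_space:
  assumes "coord_sum x = 0" "c\<^sub>0 x \<noteq> 0"
  shows "r\<^sub>0 (to_space x) = (B\<^sub>2 x x)\<^sup>2 * (c\<^sub>0 x) ^ 4 * transversal x"
proof -
  define y where "y = to_space x"
  define s where "s = c\<^sub>0 x * B\<^sub>2 x x"
  have sx: "s *s x = c\<^sub>0 x *s off_line y + (c\<^sub>2 x *s line_pt y + c\<^sub>4 x *s
      line_pt' y)"
    using reconstruct[OF assms(1)] unfolding s_def y_def by (simp add: add.assoc)
  have on_line_polar: "f u v + f v u = 0"
    if "bilinear_form f" "\<And>m l. f (m *s line_pt y + l *s line_pt' y) (m *s line_pt y + l *s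
        line_pt' y) = 0"
      "u = m\<^sub>1 *s line_pt y + l\<^sub>1 *s line_pt' y" "v = m\<^sub>2 *s line_pt y +
          l\<^sub>2 *s line_pt' y" for f u v m\<^sub>1 l\<^sub>1 m\<^sub>2 l\<^sub>2
  proof -
    have "u + v = (m\<^sub>1 + m\<^sub>2) *s line_pt y + (l\<^sub>1 + l\<^sub>2) *s line_pt' y"
      unfolding that(3,4) by (simp add: vec_eq_iff algebra_simps)
    then have "f (u + v) (u + v) = 0" "f u u = 0" "f v v = 0" using that(2-4) by metis+
    then show ?thesis by (simp add: bilinear_form_simps[OF that(1)] add.commute)
  qed
  have key: "f (off_line y) v + f v (off_line y) = B\<^sub>2 x x * (f x v + f v x)"
    if f: "bilinear_form f" "\<And>m l. f (m *s line_pt y + l *s line_pt' y) (m *s line_pt y + l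
        *s line_pt' y) = 0"
      and v: "v = m\<^sub>2 *s line_pt y + l\<^sub>2 *s line_pt' y" for f v m\<^sub>2 l\<^sub>2
  proof -
    define u where "u = c\<^sub>2 x *s line_pt y + c\<^sub>4 x *s line_pt' y"
    have "s * (f x v + f v x) = f (s *s x) v + f v (s *s x)"
      by (simp add: bilinear_form_simps[OF f(1)] algebra_simps)
    also have "\<dots> = c\<^sub>0 x * (f (off_line y) v + f v (off_line y)) + (f u v + f v u)"
      unfolding sx u_def[symmetric] by (simp add: bilinear_form_simps[OF f(1)] algebra_simps)
    also have "f u v + f v u = 0" by (rule on_line_polar[OF f u_def v])
    finally show ?thesis using assms(2) unfolding s_def by (simp add: mult.assoc)
  qed
  have p: "line_pt y = 1 *s line_pt y + 0 *s line_pt' y" "line_pt' y = 0 *s line_pt y + 1 *s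
      line_pt' y"
    by simp_all
  note k1 = key[OF bilinear_fibre_form(1)[of y] fibre_form_on_line(1)]
  note k2 = key[OF bilinear_fibre_form(2)[of y] fibre_form_on_line(2)]
  have dir: "line_pt y = c\<^sub>0 x *s line_dir x" "line_pt' y = c\<^sub>0 x *s line_dir' x"
    unfolding line_pt_def line_pt'_def line_dir_def line_dir'_def y_def to_space_nth
    by (simp_all add: vec_eq_iff algebra_simps)
  have forms: "fibre_form y x v + fibre_form y v x = c\<^sub>0 x * polar x v"
    "fibre_form' y x v + fibre_form' y v x = c\<^sub>0 x * polar' x v" for v
    unfolding fibre_form_def fibre_form'_def polar_def polar'_def y_def to_space_nth
    by (simp_all add: algebra_simps)
  have polar_scale: "polar x (c *s v) = c * polar x v" "polar' x (c *s v) = c * polar' x v" for c v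
    unfolding polar_def polar'_def
    by (simp_all add: bilinear[THEN bilinear_form_simps(3)] bilinear[THEN bilinear_form_simps(4)]
        algebra_simps)
  have coeffs: "coeff\<^sub>1 fibre_form y = (B\<^sub>2 x x * (c\<^sub>0 x)\<^sup>2) * polar x
      (line_dir x)"
    "coeff\<^sub>2 fibre_form y = (B\<^sub>2 x x * (c\<^sub>0 x)\<^sup>2) * polar x (line_dir' x)"
    "coeff\<^sub>1 fibre_form' y = (B\<^sub>2 x x * (c\<^sub>0 x)\<^sup>2) * polar' x (line_dir x)"
    "coeff\<^sub>2 fibre_form' y = (B\<^sub>2 x x * (c\<^sub>0 x)\<^sup>2) * polar' x (line_dir' x)"
    unfolding coeff\<^sub>1_def coeff\<^sub>2_def k1[OF p(1)] k1[OF p(2)] k2[OF p(1)] k2[OF p(2)]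
        forms
    unfolding dir polar_scale by (simp_all add: power2_eq_square)
  show ?thesis
    unfolding r\<^sub>0_def transversal_def y_def[symmetric] coeffs by algebra
qed

lemma homogeneous_points:
  "homogeneous_poly 1 (\<lambda>y. off_line y $ i)" "homogeneous_poly 1 (\<lambda>y. line_pt y $ i)"
  "homogeneous_poly 1 (\<lambda>y. line_pt' y $ i)"
  unfolding off_line_def line_pt_def line_pt'_def vector_add_component vector_smult_component
  by (intro homogeneous_poly_add homogeneous_poly_times_const homogeneous_poly_cmult
      homogeneous_poly_coord)+

lemma homogeneous_fibre_form:
  assumes u: "\<And>i. homogeneous_poly 1 (\<lambda>y. u y $ i)" and v: "\<And>i. homogeneous_poly
      1 (\<lambda>y. v y $ i)"
  shows "homogeneous_poly 3 (\<lambda>y. fibre_form y (u y) (v y))"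
    "homogeneous_poly 3 (\<lambda>y. fibre_form' y (u y) (v y))"
proof -
  have "homogeneous_poly (1 + (1 + 1)) (\<lambda>y. y $ j * B (u y) (v y))" if "bilinear_form B"
      for B j
    by (intro homogeneous_poly_mult homogeneous_poly_coord bilinear_form_homogeneous that u v)
  then have "homogeneous_poly 3 (\<lambda>y. y $ j * B (u y) (v y))" if "bilinear_form B" for B j
    using that by (simp add: numeral_3_eq_3)
  then show "homogeneous_poly 3 (\<lambda>y. fibre_form y (u y) (v y))"
    "homogeneous_poly 3 (\<lambda>y. fibre_form' y (u y) (v y))"
    unfolding fibre_form_def fibre_form'_def by (intro homogeneous_poly_diff; use bilinear in
        blast)+
qed

lemma homogeneous_coeffs:
  "homogeneous_poly 3 (coeff\<^sub>0 fibre_form)" "homogeneous_poly 3 (coeff\<^sub>0 fibre_form')"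
  "homogeneous_poly 3 (coeff\<^sub>1 fibre_form)" "homogeneous_poly 3 (coeff\<^sub>1 fibre_form')"
  "homogeneous_poly 3 (coeff\<^sub>2 fibre_form)" "homogeneous_poly 3 (coeff\<^sub>2 fibre_form')"
  unfolding coeff\<^sub>0_def[abs_def] coeff\<^sub>1_def[abs_def] coeff\<^sub>2_def[abs_def]
  by (intro homogeneous_poly_add homogeneous_fibre_form homogeneous_points)+

lemma homogeneous_r:
  "homogeneous_poly 6 r\<^sub>0" "homogeneous_poly 6 r\<^sub>1" "homogeneous_poly 6 r\<^sub>2"
proof -
  have "homogeneous_poly 6 (\<lambda>y. f y * g y - f' y * g' y)"
    if "homogeneous_poly 3 f" "homogeneous_poly 3 g" "homogeneous_poly 3 f'" "homogeneous_poly 3 g'"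
    for f g f' g' :: "'k ^ 4 \<Rightarrow> 'k"
    using homogeneous_poly_diff[OF homogeneous_poly_mult[OF that(1,2)] homogeneous_poly_mult[OF
        that(3,4)]]
    by simp
  then show "homogeneous_poly 6 r\<^sub>0" "homogeneous_poly 6 r\<^sub>1" "homogeneous_poly 6
      r\<^sub>2"
    unfolding r\<^sub>0_def[abs_def] r\<^sub>1_def[abs_def] r\<^sub>2_def[abs_def] by (blast
        intro: homogeneous_coeffs)+
qed

lemma homogeneous_from_space: "homogeneous_poly 7 (\<lambda>y. from_space y $ i)"
proof -
  have "homogeneous_poly 7 (\<lambda>y. f y * g y)" if "homogeneous_poly 6 f" "homogeneous_poly 1 g"
    for f g :: "'k ^ 4 \<Rightarrow> 'k"
    using homogeneous_poly_mult[OF that] by simp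
  then show ?thesis
    unfolding from_space_def vector_add_component vector_smult_component
    by (intro homogeneous_poly_add; blast intro: homogeneous_r homogeneous_points)
qed

lemma homogeneous_form_times_quadric:
  assumes "linear_form c" "bilinear_form B"
  shows "homogeneous_poly 3 (\<lambda>x. c x * B x x)"
proof -
  have "homogeneous_poly (1 + (1 + 1)) (\<lambda>x. c x * B x x)"
    by (intro homogeneous_poly_mult linear_form_homogeneous[OF assms(1), of 1 "\<lambda>x. x"]
        bilinear_form_homogeneous[OF assms(2), of 1 "\<lambda>x. x" 1 "\<lambda>x. x"]
            homogeneous_poly_coord)
  then show ?thesis by (simp add: numeral_3_eq_3)
qed

lemma homogeneous_to_space: "homogeneous_poly 3 (\<lambda>x. to_space x $ i)"
proof -
  have tm: "homogeneous_poly 3 (\<lambda>x. c x * B x x)" if "linear_form c" "bilinear_form B"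
    for c :: "'k ^ 6 \<Rightarrow> 'k" and B
    using that by (rule homogeneous_form_times_quadric)
  have "linear_form (\<lambda>x. \<delta> * c\<^sub>4 x)" by (intro linear_form_cmult linear)
  note terms = tm[OF linear(1) bilinear(2)] tm[OF linear(1) bilinear(1)]
    homogeneous_poly_diff[OF tm[OF linear(2) bilinear(2)] tm[OF linear(3) bilinear(1)]]
    homogeneous_poly_diff[OF tm[OF linear(4) bilinear(2)] tm[OF this bilinear(1)]]
  then have "homogeneous_poly 3 (\<lambda>x. to_space x $ 1)" "homogeneous_poly 3 (\<lambda>x.
      to_space x $ 2)"
    "homogeneous_poly 3 (\<lambda>x. to_space x $ 3)" "homogeneous_poly 3 (\<lambda>x. to_space x
        $ 4)"
    unfolding to_space_nth .
  then show ?thesis using exhaust_4[of i] by auto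
qed

text \<open>The line with base point \<open>x\<^sub>0\<close> and direction \<open>w\<close> is the test line for density. The condition
  at its points says that each of them lies in the domain of \<open>to_space\<close> and is recovered by
  \<open>from_space\<close>.\<close>
theorem rational:
  assumes "k \<noteq> 0"
    and line: "coord_sum x\<^sub>0 = 0" "coord_sum w = 0" "quartic_form t w \<noteq> 0"
      "\<And>z x. x = x\<^sub>0 + z *s w \<Longrightarrow> quartic_form t x = 0 \<Longrightarrow>
        c\<^sub>0 x \<noteq> 0 \<and> B\<^sub>2 x x \<noteq> 0 \<and> transversal x \<noteq> 0"
  shows "rational_threefold (quartic t)"
proof (rule rational_threefold_quarticI[where F = to_space and G = from_space and x\<^sub>0 =
    x\<^sub>0 and w = w
      and a = "\<lambda>x. c\<^sub>0 x * B\<^sub>2 x x" and b = "\<lambda>y. y $ 1 * r\<^sub>0 y"])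
  show "homogeneous_poly 3 (\<lambda>x. to_space x $ j)" for j by (rule homogeneous_to_space)
  show "homogeneous_poly 7 (\<lambda>y. from_space y $ j)" for j by (rule homogeneous_from_space)
  show "homogeneous_poly 3 (\<lambda>x. c\<^sub>0 x * B\<^sub>2 x x)"
    by (rule homogeneous_form_times_quadric[OF linear(1) bilinear(2)])
  show "homogeneous_poly (1 + 6) (\<lambda>y. y $ 1 * r\<^sub>0 y)"
    by (intro homogeneous_poly_mult homogeneous_poly_coord homogeneous_r)
  show "\<exists>c. c \<noteq> 0 \<and> from_space (to_space x) = c *s x"
    if "coord_sum x = 0" "quartic_form t x = 0" "c\<^sub>0 x * B\<^sub>2 x x \<noteq> 0" "to_space
        x $ 1 * r\<^sub>0 (to_space x) \<noteq> 0" for x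
    using from_to_space[OF that(1,2) assms(1) that(3)] that(3,4)
    by (intro exI[of _ "r\<^sub>0 (to_space x) * B\<^sub>2 x x"]) auto
  show "coord_sum (from_space y) = 0 \<and> quartic_form t (from_space y) = 0" if "y $ 1 *
      r\<^sub>0 y \<noteq> 0" for y
    using from_space_in_quartic that by auto
  show "\<exists>c. c \<noteq> 0 \<and> to_space (from_space y) = c *s y"
    if "y $ 1 * r\<^sub>0 y \<noteq> 0" "c\<^sub>0 (from_space y) * B\<^sub>2 (from_space y)
        (from_space y) \<noteq> 0" for y
    using to_from_space[of y] that
    by (intro exI[of _ "r\<^sub>0 y * B\<^sub>2 (from_space y) (from_space y)"]) auto
  show "c\<^sub>0 (x\<^sub>0 + z *s w) * B\<^sub>2 (x\<^sub>0 + z *s w) (x\<^sub>0 + z *s w)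
      \<noteq> 0 \<and>
      to_space (x\<^sub>0 + z *s w) $ 1 * r\<^sub>0 (to_space (x\<^sub>0 + z *s w)) \<noteq> 0"
    if "quartic_form t (x\<^sub>0 + z *s w) = 0" for z
  proof -
    have "coord_sum (x\<^sub>0 + z *s w) = 0" using line(1,2) by (simp add: coord_sum_add)
    then show ?thesis
      using line(4)[OF refl that] r\<^sub>0_to_space by (simp add: to_space_nth(1))
  qed
qed (use line in auto)

end

section \<open>The four quartics\<close>

lemma exhaust_6:
  fixes x :: 6
  shows "x = 1 \<or> x = 2 \<or> x = 3 \<or> x = 4 \<or> x = 5 \<or> x = 6"
proof (induct x)
  case (of_int z)
  then have "z = 0 \<or> z = 1 \<or> z = 2 \<or> z = 3 \<or> z = 4 \<or> z = 5" by fastforce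
  then show ?case by auto
qed

lemma forall_6: "(\<forall>i::6. P i) \<longleftrightarrow> P 1 \<and> P 2 \<and> P 3 \<and> P 4
    \<and> P 5 \<and> P 6"
  by (metis exhaust_6)

lemma UNIV_6: "UNIV = {1, 2, 3, 4, 5, 6::6}"
  using exhaust_6 by auto

lemma sum_6: "sum f (UNIV::6 set) = f 1 + f 2 + f 3 + f 4 + f 5 + f 6"
  unfolding UNIV_6 by (simp add: ac_simps)

lemma vector_6:
  "(vector [a, b, c, d, e, f] :: 'a::zero ^ 6) $ 1 = a"
  "(vector [a, b, c, d, e, f] :: 'a::zero ^ 6) $ 2 = b"
  "(vector [a, b, c, d, e, f] :: 'a::zero ^ 6) $ 3 = c"
  "(vector [a, b, c, d, e, f] :: 'a::zero ^ 6) $ 4 = d"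
  "(vector [a, b, c, d, e, f] :: 'a::zero ^ 6) $ 5 = e"
  "(vector [a, b, c, d, e, f] :: 'a::zero ^ 6) $ 6 = f"
  unfolding vector_def by simp_all

lemma quartic_form_fraction:
  fixes x :: "'k::field ^ 6"
  assumes "n \<noteq> 0"
  shows "n * quartic_form (m / n) x =
    n * (x $ 1 ^ 4 + x $ 2 ^ 4 + x $ 3 ^ 4 + x $ 4 ^ 4 + x $ 5 ^ 4 + x $ 6 ^ 4)
    - m * ((x $ 1)\<^sup>2 + (x $ 2)\<^sup>2 + (x $ 3)\<^sup>2 + (x $ 4)\<^sup>2 + (x $ 5)\<^sup>2
        + (x $ 6)\<^sup>2)\<^sup>2"
  using assms unfolding quartic_form_def sum_6 by (simp add: field_simps)

text \<open>The bilinear forms \<open>N\<^sub>1\<^sub>2\<close> and \<open>e\<^sub>3\<^sub>6\<close> represent the quadratic forms \<open>N\<close> and \<open>e\<close>.\<close>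
definition N\<^sub>1\<^sub>2 :: "'k::field ^ 6 \<Rightarrow> 'k ^ 6 \<Rightarrow> 'k" where
  "N\<^sub>1\<^sub>2 x y = x $ 1 * y $ 1 + x $ 1 * y $ 2 + x $ 2 * y $ 2"

definition e\<^sub>3\<^sub>6 :: "'k::field ^ 6 \<Rightarrow> 'k ^ 6 \<Rightarrow> 'k" where
  "e\<^sub>3\<^sub>6 x y = x $ 3 * y $ 4 + x $ 3 * y $ 5 + x $ 3 * y $ 6 + x $ 4 * y $ 5 + x $ 4 *
      y $ 6 + x $ 5 * y $ 6"

definition z\<^sub>1\<^sub>2 :: "6 \<Rightarrow> 'k::field ^ 6 \<Rightarrow> 'k" where
  "z\<^sub>1\<^sub>2 i x = x $ 1 + x $ 2 + x $ i"

lemmas form_defs = N\<^sub>1\<^sub>2_def e\<^sub>3\<^sub>6_def z\<^sub>1\<^sub>2_def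

lemma last_coord:
  fixes x :: "'k::field ^ 6"
  assumes "coord_sum x = 0"
  shows "x $ 6 = - (x $ 1 + x $ 2 + x $ 3 + x $ 4 + x $ 5)"
  using assms unfolding coord_sum_def sum_6 by algebra

text \<open>For \<open>t = 1/4\<close> this says that each of the four hyperplanes \<open>z\<^sub>i = 0\<close> touches the quartic
  along the quadric \<open>N + e = 0\<close>. The other quartics differ from this one by a multiple of the
  square of \<open>2 (N - e)\<close>, which equals \<open>\<Sum>x\<^sub>i\<^sup>2\<close> where the coordinates sum to zero.\<close>
lemma quartic_form_NE:
  fixes x :: "'k::field ^ 6"
  assumes "coord_sum x = 0"
  shows "quartic_form t x = (N\<^sub>1\<^sub>2 x x + e\<^sub>3\<^sub>6 x x)\<^sup>2 - (4 * t - 1)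
      * (e\<^sub>3\<^sub>6 x x - N\<^sub>1\<^sub>2 x x)\<^sup>2
    - 4 * (z\<^sub>1\<^sub>2 3 x * z\<^sub>1\<^sub>2 4 x * z\<^sub>1\<^sub>2 5 x *
        z\<^sub>1\<^sub>2 6 x)"
  unfolding quartic_form_def form_defs sum_6 last_coord[OF assms] by algebra

lemma bilinear_N\<^sub>1\<^sub>2 [form_intros]: "bilinear_form N\<^sub>1\<^sub>2"
  unfolding N\<^sub>1\<^sub>2_def[abs_def] by (intro form_intros)

lemma bilinear_e\<^sub>3\<^sub>6 [form_intros]: "bilinear_form e\<^sub>3\<^sub>6"
  unfolding e\<^sub>3\<^sub>6_def[abs_def] by (intro form_intros)

lemma linear_z\<^sub>1\<^sub>2 [form_intros]: "linear_form (z\<^sub>1\<^sub>2 i)"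
  unfolding z\<^sub>1\<^sub>2_def[abs_def] by (intro form_intros)

lemma cube_root_of_unity_exists:
  "\<exists>\<omega> :: 'k::alg_closed_field. \<omega>\<^sup>2 + \<omega> + 1 = 0"
proof -
  have "degree [:1, 1, 1 :: 'k:] > 0" by simp
  then obtain \<omega> where "poly [:1, 1, 1 :: 'k:] \<omega> = 0"
    using alg_closed_imp_poly_has_root by blast
  then show ?thesis by (intro exI[of _ \<omega>]) (simp add: algebra_simps power2_eq_square)
qed

lemma quartic_form_NE_fraction:
  fixes x :: "'k::field ^ 6"
  assumes "coord_sum x = 0" "n \<noteq> 0"
  shows "n * quartic_form (m / n) x =
    n * (N\<^sub>1\<^sub>2 x x + e\<^sub>3\<^sub>6 x x)\<^sup>2 - (4 * m - n) * (e\<^sub>3\<^sub>6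
        x x - N\<^sub>1\<^sub>2 x x)\<^sup>2
    - 4 * n * (z\<^sub>1\<^sub>2 3 x * z\<^sub>1\<^sub>2 4 x * z\<^sub>1\<^sub>2 5 x *
        z\<^sub>1\<^sub>2 6 x)"
proof -
  have "n * (4 * (m / n) - 1) = 4 * m - n" using assms(2) by (simp add: field_simps)
  then show ?thesis unfolding quartic_form_NE[OF assms(1)] by algebra
qed

lemma eq_fraction_times:
  fixes q :: "'k::field"
  assumes "n * q = m * d" "n \<noteq> 0"
  shows "q = m / n * d"
  using assms by (simp add: field_simps)

text \<open>With this, a partition of the six indices into three pairs (a syntheme) gives the quadratic
  form \<open>x\<^sub>a x\<^sub>b + x\<^sub>c x\<^sub>d + x\<^sub>e x\<^sub>f\<close>.\<close>
definition pair_form :: "6 \<Rightarrow> 6 \<Rightarrow> 6 \<Rightarrow> 6 \<Rightarrow> 6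
    \<Rightarrow> 6 \<Rightarrow> 'k::field ^ 6 \<Rightarrow> 'k ^ 6 \<Rightarrow> 'k" where
  "pair_form a b c d e f x y = x $ a * y $ b + x $ c * y $ d + x $ e * y $ f"

lemma bilinear_pair_form [form_intros]: "bilinear_form (pair_form a b c d e f)"
  unfolding pair_form_def[abs_def] by (intro form_intros)

text \<open>The five synthemes of a total: every pair of indices occurs in exactly one of them.\<close>
abbreviation "\<sigma>\<^sub>1 \<equiv> pair_form 1 2 3 4 5 6"
abbreviation "\<sigma>\<^sub>2 \<equiv> pair_form 1 3 2 5 4 6"
abbreviation "\<sigma>\<^sub>3 \<equiv> pair_form 1 4 2 6 3 5"
abbreviation "\<sigma>\<^sub>4 \<equiv> pair_form 1 5 2 4 3 6"
abbreviation "\<sigma>\<^sub>5 \<equiv> pair_form 1 6 2 3 4 5"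

text \<open>Up to sign and scale, the right-hand side is the sum of the squares of the deviations of the
  \<open>\<sigma>\<^sub>i\<close> from their mean. Its rank is four, and a quadratic form of rank four is a determinant of
  linear forms.\<close>
lemma quartic_form_total:
  fixes x :: "'k::field_char_0 ^ 6"
  assumes "coord_sum x = 0"
  shows "10 * quartic_form (7 / 10) x =
    2 * (\<sigma>\<^sub>1 x x + \<sigma>\<^sub>2 x x + \<sigma>\<^sub>3 x x + \<sigma>\<^sub>4 x x
        + \<sigma>\<^sub>5 x x)\<^sup>2
    - 10 * ((\<sigma>\<^sub>1 x x)\<^sup>2 + (\<sigma>\<^sub>2 x x)\<^sup>2 + (\<sigma>\<^sub>3 x
        x)\<^sup>2 + (\<sigma>\<^sub>4 x x)\<^sup>2 + (\<sigma>\<^sub>5 x x)\<^sup>2)"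
  unfolding quartic_form_fraction[OF zero_neq_numeral[symmetric]] pair_form_def last_coord[OF assms]
  by algebra

lemma golden_ratio_exists: "\<exists>\<phi> :: 'k::alg_closed_field. \<phi>\<^sup>2 - \<phi> - 1 =
    0"
proof -
  have "degree [:- 1, - 1, 1 :: 'k:] > 0" by simp
  then obtain \<phi> where "poly [:- 1, - 1, 1 :: 'k:] \<phi> = 0"
    using alg_closed_imp_poly_has_root by blast
  then show ?thesis by (intro exI[of _ \<phi>]) (simp add: algebra_simps power2_eq_square)
qed

text \<open>The plane spanned by \<open>e\<^sub>1, e\<^sub>2, e\<^sub>4\<close> lies on the quartic. The equation is \<open>N e = z\<^sub>3 z\<^sub>4 z\<^sub>5
  z\<^sub>6\<close> with \<open>N\<close> split into linear factors. The test line lies in the hyperplane \<open>x\<^sub>6 = \<omega> x\<^sub>1\<close>,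
  which cuts the quartic in four planes; so the intersection points are rational over \<open>\<omega>\<close>.\<close>
lemma burkhardt_quartic_rational:
  fixes \<omega> :: "'k::{alg_closed_field, field_char_0}"
  assumes \<omega>: "\<omega>\<^sup>2 + \<omega> + 1 = 0"
  shows "rational_threefold (quartic (1/2 :: 'k))"
proof -
  define B\<^sub>1 where "B\<^sub>1 = (\<lambda>(x :: 'k ^ 6) (y :: 'k ^ 6). (x $ 1 - \<omega> * x
      $ 2) * (y $ 1 - \<omega>\<^sup>2 * y $ 2))"
  define B\<^sub>2 where "B\<^sub>2 = (\<lambda>(x :: 'k ^ 6) (y :: 'k ^ 6). z\<^sub>1\<^sub>2 3 x
      * z\<^sub>1\<^sub>2 4 y)"
  define B\<^sub>3 where "B\<^sub>3 = (\<lambda>(x :: 'k ^ 6) (y :: 'k ^ 6). z\<^sub>1\<^sub>2 5 x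
      * z\<^sub>1\<^sub>2 6 y)"
  define B\<^sub>4 where "B\<^sub>4 = (\<lambda>(x :: 'k ^ 6) (y :: 'k ^ 6). e\<^sub>3\<^sub>6 x y)"
  define c\<^sub>0 where "c\<^sub>0 = (\<lambda>x :: 'k ^ 6. x $ 1 + x $ 3 + x $ 5)"
  define c\<^sub>1 where "c\<^sub>1 = (\<lambda>x :: 'k ^ 6. (x $ 2 - \<omega> * x $ 1) / 3)"
  define c\<^sub>2 where "c\<^sub>2 = (\<lambda>x :: 'k ^ 6. z\<^sub>1\<^sub>2 4 x / 3)"
  define c\<^sub>3 where "c\<^sub>3 = (\<lambda>x :: 'k ^ 6. x $ 3 - \<omega> * x $ 1)"
  define c\<^sub>4 where "c\<^sub>4 = (\<lambda>x :: 'k ^ 6. ((1 - \<omega>) * x $ 1 - (1 + 2 *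
      \<omega>) * x $ 2) / 3)"
  define e\<^sub>0 :: "'k ^ 6" where "e\<^sub>0 = vector [0, 0, 0, 0, 1, - 1]"
  define e\<^sub>1 :: "'k ^ 6" where "e\<^sub>1 = vector [1 + 2 * \<omega>, 1 - \<omega>, - 2 -
      \<omega>, - 2 - \<omega>, 1 - \<omega>, 1 + 2 * \<omega>]"
  define e\<^sub>2 :: "'k ^ 6" where "e\<^sub>2 = vector [0, 0, 0, 3, 0, - 3]"
  define e\<^sub>3 :: "'k ^ 6" where "e\<^sub>3 = vector [0, 0, 1, 0, - 1, 0]"
  define e\<^sub>4 :: "'k ^ 6" where "e\<^sub>4 = vector [1, \<omega>, \<omega>, - 1 - \<omega>, -
      1 - \<omega>, 1]"
  note B_defs = B\<^sub>1_def B\<^sub>2_def B\<^sub>3_def B\<^sub>4_def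
  note c_defs = c\<^sub>0_def c\<^sub>1_def c\<^sub>2_def c\<^sub>3_def c\<^sub>4_def
  note e_defs = e\<^sub>0_def e\<^sub>1_def e\<^sub>2_def e\<^sub>3_def e\<^sub>4_def
  interpret line_pencil B\<^sub>1 B\<^sub>2 B\<^sub>3 B\<^sub>4 c\<^sub>0 c\<^sub>1 c\<^sub>2
      c\<^sub>3 c\<^sub>4 e\<^sub>0 e\<^sub>1 e\<^sub>2 e\<^sub>3 e\<^sub>4 0 "4" "1/2"
  proof unfold_locales
    show "bilinear_form B\<^sub>1" "bilinear_form B\<^sub>2" "bilinear_form B\<^sub>3"
        "bilinear_form B\<^sub>4"
      unfolding B_defs by (intro form_intros)+
    show "linear_form c\<^sub>0" "linear_form c\<^sub>1" "linear_form c\<^sub>2" "linear_form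
        c\<^sub>3" "linear_form c\<^sub>4"
      unfolding c_defs by (intro form_intros)+
    show "x = c\<^sub>0 x *s e\<^sub>0 + c\<^sub>1 x *s e\<^sub>1 + c\<^sub>2 x *s e\<^sub>2 +
        c\<^sub>3 x *s e\<^sub>3 + c\<^sub>4 x *s e\<^sub>4"
      if "coord_sum x = 0" for x
      unfolding vec_eq_iff forall_6 c_defs e_defs vector_add_component vector_smult_component
        vector_6 last_coord[OF that] z\<^sub>1\<^sub>2_def
      by (intro conjI; (simp add: field_simps)?; (use \<omega> in algebra)?)
    show "c\<^sub>0 x = r\<^sub>0 \<and> c\<^sub>1 x = r\<^sub>1 \<and> c\<^sub>2 x = r\<^sub>2
        \<and> c\<^sub>3 x = r\<^sub>3 \<and> c\<^sub>4 x = r\<^sub>4"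
      if x: "x = r\<^sub>0 *s e\<^sub>0 + r\<^sub>1 *s e\<^sub>1 + r\<^sub>2 *s e\<^sub>2 +
          r\<^sub>3 *s e\<^sub>3 + r\<^sub>4 *s e\<^sub>4"
      for x r\<^sub>0 r\<^sub>1 r\<^sub>2 r\<^sub>3 r\<^sub>4
      unfolding x c_defs e_defs z\<^sub>1\<^sub>2_def vector_add_component vector_smult_component
          vector_6
      by (intro conjI; (simp add: field_simps)?; (use \<omega> in algebra)?)
    show "y\<^sub>1 * B\<^sub>1 x x = y\<^sub>2 * B\<^sub>2 x x \<and> y\<^sub>1 * B\<^sub>3 x x =
        y\<^sub>2 * B\<^sub>4 x x"
      if x: "x = m *s (y\<^sub>2 *s e\<^sub>1 + y\<^sub>1 *s e\<^sub>2) + l *s ((0 * y\<^sub>2) *s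
          e\<^sub>3 + y\<^sub>1 *s e\<^sub>4)"
      for x m l y\<^sub>1 y\<^sub>2
      unfolding x B_defs e_defs form_defs vector_add_component vector_smult_component vector_6
      by (intro conjI; use \<omega> in algebra)
    show "quartic_form (1/2) x = 4 * (B\<^sub>1 x x * B\<^sub>4 x x - B\<^sub>2 x x * B\<^sub>3 x
        x)"
      if x: "coord_sum x = 0" for x
      unfolding quartic_form_NE[OF x] B_defs form_defs using \<omega> by algebra
  qed (simp_all add: e_defs coord_sum_def sum_6 vector_6)
  show ?thesis
  proof (rule rational[where x\<^sub>0 = "vector [1, - 1 - \<omega>, 0, 0, 0, \<omega>]" and w =
      "vector [0, - 1 - \<omega>, 1 + \<omega>, 1 + \<omega>, - 1 - \<omega>, 0]"])
    show "4 \<noteq> (0 :: 'k)"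
      by simp
    show "quartic_form (1/2) (vector [0, - 1 - \<omega>, 1 + \<omega>, 1 + \<omega>, - 1 -
        \<omega>, 0] :: 'k ^ 6) \<noteq> 0"
      proof -
      have "2 * quartic_form (1/2) (vector [0, - 1 - \<omega>, 1 + \<omega>, 1 + \<omega>, - 1 -
          \<omega>, 0] :: 'k ^ 6) * \<omega> = - 8"
        unfolding quartic_form_fraction[OF zero_neq_numeral[symmetric]] vector_6
        using \<omega> by (simp only: power_zero_numeral power_one) algebra
      then show ?thesis by auto
    qed
    fix z and x :: "'k ^ 6"
    assume x: "x = vector [1, - 1 - \<omega>, 0, 0, 0, \<omega>] + z *s vector [0, - 1 - \<omega>,
        1 + \<omega>, 1 + \<omega>, - 1 - \<omega>, 0]" and root: "quartic_form (1/2) x = 0"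
    have xs: "x $ 1 = 1" "x $ 2 = - 1 - \<omega> + (- 1 - \<omega>) * z"
      "x $ 3 = (1 + \<omega>) * z" "x $ 4 = (1 + \<omega>) * z" "x $ 5 = (- 1 - \<omega>) * z"
      "x $ 6 = \<omega>"
      unfolding x by (simp_all add: vector_6)
    have "2 * quartic_form (1/2) x * \<omega> = - 8 * (z * (z + 1)\<^sup>2 * (z - 1))"
      unfolding quartic_form_fraction[OF zero_neq_numeral[symmetric]] xs
      using \<omega> by (simp only: power_zero_numeral power_one) algebra
    then have "z * (z + 1)\<^sup>2 * (z - 1) = 0" using root by simp
    then consider "z = 0" | "z = - 1" | "z = 1"
      by (auto simp: eq_neg_iff_add_eq_0)
    then show "c\<^sub>0 x \<noteq> 0 \<and> B\<^sub>2 x x \<noteq> 0 \<and> transversal x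
        \<noteq> 0"
    proof cases
      case 1
      have at_root: "x $ 1 = 1" "x $ 2 = - 1 - \<omega>" "x $ 3 = 0" "x $ 4 = 0" "x $ 5 = 0"
        "x $ 6 = \<omega>"
        unfolding xs 1 by (rule refl | use \<omega> in algebra | algebra | simp)+
      have q: "B\<^sub>1 x x = 0" "B\<^sub>2 x x = - 1 - \<omega>"
        unfolding B_defs form_defs at_root by (rule refl | use \<omega> in algebra | algebra |
            simp)+
      have c: "c\<^sub>0 x = 1"
        unfolding c_defs form_defs at_root by ((simp add: field_simps)?; (use \<omega> in algebra)?)
      have tr: "transversal x = - 9"
        unfolding transversal_def polar_def polar'_def line_dir_def line_dir'_def q
        unfolding B_defs e_defs form_defs vector_add_component vector_smult_component vector_6
            at_root
        using \<omega> by algebra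
      have "B\<^sub>2 x x * \<omega> = 1" unfolding q using \<omega> by algebra
      then have "B\<^sub>2 x x \<noteq> 0" by auto
      moreover have "c\<^sub>0 x \<noteq> 0" unfolding c by simp
      moreover have "transversal x \<noteq> 0" unfolding tr by simp
      ultimately show ?thesis by simp
    next
      case 2
      have at_root: "x $ 1 = 1" "x $ 2 = 0" "x $ 3 = - 1 - \<omega>" "x $ 4 = - 1 - \<omega>"
        "x $ 5 = 1 + \<omega>" "x $ 6 = \<omega>"
        unfolding xs 2 by (rule refl | use \<omega> in algebra | algebra | simp)+
      have q: "B\<^sub>1 x x = 1" "B\<^sub>2 x x = - 1 - \<omega>"
        unfolding B_defs form_defs at_root by (rule refl | use \<omega> in algebra | algebra |
            simp)+
      have c: "c\<^sub>0 x = 1"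
        unfolding c_defs form_defs at_root by ((simp add: field_simps)?; (use \<omega> in algebra)?)
      have tr: "transversal x = - 18 - 9 * \<omega>"
        unfolding transversal_def polar_def polar'_def line_dir_def line_dir'_def q
        unfolding B_defs e_defs form_defs vector_add_component vector_smult_component vector_6
            at_root
        using \<omega> by algebra
      have "B\<^sub>2 x x * \<omega> = 1" unfolding q using \<omega> by algebra
      then have "B\<^sub>2 x x \<noteq> 0" by auto
      moreover have "c\<^sub>0 x \<noteq> 0" unfolding c by simp
      moreover have "transversal x * (- 1 + \<omega>) = 27" unfolding tr using \<omega> by algebra
      then have "transversal x \<noteq> 0" by auto
      ultimately show ?thesis by simp
    next
      case 3
      have at_root: "x $ 1 = 1" "x $ 2 = - 2 - 2 * \<omega>" "x $ 3 = 1 + \<omega>"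
        "x $ 4 = 1 + \<omega>" "x $ 5 = - 1 - \<omega>" "x $ 6 = \<omega>"
        unfolding xs 3 by (rule refl | use \<omega> in algebra | algebra | simp)+
      have q: "B\<^sub>1 x x = - 1 + 2 * \<omega>" "B\<^sub>2 x x = - 1 - \<omega>"
        unfolding B_defs form_defs at_root by (rule refl | use \<omega> in algebra | algebra |
            simp)+
      have c: "c\<^sub>0 x = 1"
        unfolding c_defs form_defs at_root by ((simp add: field_simps)?; (use \<omega> in algebra)?)
      have tr: "transversal x = 72 + 45 * \<omega>"
        unfolding transversal_def polar_def polar'_def line_dir_def line_dir'_def q
        unfolding B_defs e_defs form_defs vector_add_component vector_smult_component vector_6
            at_root
        using \<omega> by algebra
      have "B\<^sub>2 x x * \<omega> = 1" unfolding q using \<omega> by algebra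
      then have "B\<^sub>2 x x \<noteq> 0" by auto
      moreover have "c\<^sub>0 x \<noteq> 0" unfolding c by simp
      moreover have "transversal x * (3 - 5 * \<omega>) = 441" unfolding tr using \<omega> by
          algebra
      then have "transversal x \<noteq> 0" by auto
      ultimately show ?thesis by simp
    qed
  qed (simp_all add: coord_sum_def sum_6 vector_6)
qed

text \<open>The hyperplane \<open>c\<^sub>0 = 0\<close> touches the quartic along a quadric surface, one ruling of which is
  used. On the test line only the values \<open>x\<^sub>5\<close> and \<open>x\<^sub>6\<close> vary, with constant sum; so the equation
  is a quadratic polynomial in \<open>z\<^sup>2\<close>, and the condition at its roots is tested through the norm of
  \<open>9 + z\<close>.\<close>
lemma igusa_quartic_rational:
  shows "rational_threefold (quartic (1/4 :: 'k::{alg_closed_field, field_char_0}))"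
proof -
  define B\<^sub>1 where "B\<^sub>1 = (\<lambda>(x :: 'k ^ 6) (y :: 'k ^ 6). N\<^sub>1\<^sub>2 x y
      + e\<^sub>3\<^sub>6 x y)"
  define B\<^sub>2 where "B\<^sub>2 = (\<lambda>(x :: 'k ^ 6) (y :: 'k ^ 6). 2 *
      (z\<^sub>1\<^sub>2 3 x * z\<^sub>1\<^sub>2 4 y))"
  define B\<^sub>3 where "B\<^sub>3 = (\<lambda>(x :: 'k ^ 6) (y :: 'k ^ 6). 2 *
      (z\<^sub>1\<^sub>2 5 x * z\<^sub>1\<^sub>2 6 y))"
  define B\<^sub>4 where "B\<^sub>4 = (\<lambda>(x :: 'k ^ 6) (y :: 'k ^ 6). N\<^sub>1\<^sub>2 x y
      + e\<^sub>3\<^sub>6 x y)"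
  define c\<^sub>0 where "c\<^sub>0 = (\<lambda>x :: 'k ^ 6. x $ 1 + x $ 3 + x $ 5)"
  define c\<^sub>1 where "c\<^sub>1 = (\<lambda>x :: 'k ^ 6. (x $ 6 - x $ 5) / 3)"
  define c\<^sub>2 where "c\<^sub>2 = (\<lambda>x :: 'k ^ 6. (x $ 3 - x $ 4) / 3)"
  define c\<^sub>3 where "c\<^sub>3 = (\<lambda>x :: 'k ^ 6. (x $ 2 - x $ 3) / 3)"
  define c\<^sub>4 where "c\<^sub>4 = (\<lambda>x :: 'k ^ 6. (x $ 1 - x $ 6) / 3)"
  define e\<^sub>0 :: "'k ^ 6" where "e\<^sub>0 = vector [1, - 1, - 1, - 1, 1, 1]"
  define e\<^sub>1 :: "'k ^ 6" where "e\<^sub>1 = vector [2, - 1, - 1, - 1, - 1, 2]"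
  define e\<^sub>2 :: "'k ^ 6" where "e\<^sub>2 = vector [- 1, 2, 2, - 1, - 1, - 1]"
  define e\<^sub>3 :: "'k ^ 6" where "e\<^sub>3 = vector [1, 1, - 2, - 2, 1, 1]"
  define e\<^sub>4 :: "'k ^ 6" where "e\<^sub>4 = vector [1, 1, 1, 1, - 2, - 2]"
  note B_defs = B\<^sub>1_def B\<^sub>2_def B\<^sub>3_def B\<^sub>4_def
  note c_defs = c\<^sub>0_def c\<^sub>1_def c\<^sub>2_def c\<^sub>3_def c\<^sub>4_def
  note e_defs = e\<^sub>0_def e\<^sub>1_def e\<^sub>2_def e\<^sub>3_def e\<^sub>4_def
  interpret line_pencil B\<^sub>1 B\<^sub>2 B\<^sub>3 B\<^sub>4 c\<^sub>0 c\<^sub>1 c\<^sub>2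
      c\<^sub>3 c\<^sub>4 e\<^sub>0 e\<^sub>1 e\<^sub>2 e\<^sub>3 e\<^sub>4 1 "1" "1/4"
  proof unfold_locales
    show "bilinear_form B\<^sub>1" "bilinear_form B\<^sub>2" "bilinear_form B\<^sub>3"
        "bilinear_form B\<^sub>4"
      unfolding B_defs by (intro form_intros)+
    show "linear_form c\<^sub>0" "linear_form c\<^sub>1" "linear_form c\<^sub>2" "linear_form
        c\<^sub>3" "linear_form c\<^sub>4"
      unfolding c_defs by (intro form_intros)+
    show "x = c\<^sub>0 x *s e\<^sub>0 + c\<^sub>1 x *s e\<^sub>1 + c\<^sub>2 x *s e\<^sub>2 +
        c\<^sub>3 x *s e\<^sub>3 + c\<^sub>4 x *s e\<^sub>4"
      if "coord_sum x = 0" for x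
      unfolding vec_eq_iff forall_6 c_defs e_defs vector_add_component vector_smult_component
        vector_6 last_coord[OF that] z\<^sub>1\<^sub>2_def
      by (intro conjI; (simp add: field_simps)?; algebra?)
    show "c\<^sub>0 x = r\<^sub>0 \<and> c\<^sub>1 x = r\<^sub>1 \<and> c\<^sub>2 x = r\<^sub>2
        \<and> c\<^sub>3 x = r\<^sub>3 \<and> c\<^sub>4 x = r\<^sub>4"
      if x: "x = r\<^sub>0 *s e\<^sub>0 + r\<^sub>1 *s e\<^sub>1 + r\<^sub>2 *s e\<^sub>2 +
          r\<^sub>3 *s e\<^sub>3 + r\<^sub>4 *s e\<^sub>4"
      for x r\<^sub>0 r\<^sub>1 r\<^sub>2 r\<^sub>3 r\<^sub>4
      unfolding x c_defs e_defs z\<^sub>1\<^sub>2_def vector_add_component vector_smult_component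
          vector_6
      by (intro conjI; (simp add: field_simps)?; algebra?)
    show "y\<^sub>1 * B\<^sub>1 x x = y\<^sub>2 * B\<^sub>2 x x \<and> y\<^sub>1 * B\<^sub>3 x x =
        y\<^sub>2 * B\<^sub>4 x x"
      if x: "x = m *s (y\<^sub>2 *s e\<^sub>1 + y\<^sub>1 *s e\<^sub>2) + l *s ((1 * y\<^sub>2) *s
          e\<^sub>3 + y\<^sub>1 *s e\<^sub>4)"
      for x m l y\<^sub>1 y\<^sub>2
      unfolding x B_defs e_defs form_defs vector_add_component vector_smult_component vector_6
      by (intro conjI; algebra)
    show "quartic_form (1/4) x = 1 * (B\<^sub>1 x x * B\<^sub>4 x x - B\<^sub>2 x x * B\<^sub>3 x
        x)"
      if x: "coord_sum x = 0" for x
      unfolding quartic_form_NE[OF x] B_defs form_defs by algebra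
  qed (simp_all add: e_defs coord_sum_def sum_6 vector_6)
  show ?thesis
  proof (rule rational[where x\<^sub>0 = "vector [10, - 8, - 8, - 8, 7, 7]" and w = "vector [0, 0,
      0, 0, 1, - 1]"])
    show "1 \<noteq> (0 :: 'k)"
      by simp
    show "quartic_form (1/4) (vector [0, 0, 0, 0, 1, - 1] :: 'k ^ 6) \<noteq> 0"
      unfolding quartic_form_def sum_6 vector_6 by simp
    fix z and x :: "'k ^ 6"
    assume x: "x = vector [10, - 8, - 8, - 8, 7, 7] + z *s vector [0, 0, 0, 0, 1, - 1]" and root:
        "quartic_form (1/4) x = 0"
    have xs: "x $ 1 = 10" "x $ 2 = - 8" "x $ 3 = - 8" "x $ 4 = - 8" "x $ 5 = 7 + z" "x $ 6 = 7 - z"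
      unfolding x by (simp_all add: vector_6)
    have "4 * quartic_form (1/4) x = 4 * ((z\<^sup>2 - 45) * (z\<^sup>2 + 243))"
      unfolding quartic_form_fraction[OF zero_neq_numeral[symmetric]] xs by algebra
    then consider "z\<^sup>2 = 45" | "z\<^sup>2 = - 243"
      using root by (auto simp: eq_neg_iff_add_eq_0)
    then show "c\<^sub>0 x \<noteq> 0 \<and> B\<^sub>2 x x \<noteq> 0 \<and> transversal x
        \<noteq> 0"
    proof cases
      case 1
      then have root\<^sub>z: "z\<^sup>2 - 45 = 0" by simp
      have q: "B\<^sub>1 x x = - 72" "B\<^sub>2 x x = 72"
        unfolding B_defs form_defs xs by (use root\<^sub>z in algebra | simp)+
      have c\<^sub>0: "c\<^sub>0 x = 9 + z"
        unfolding c_defs xs by simp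
      define p p' where p_defs: "p = line_dir x" "p' = line_dir' x"
      have dir: "p $ 1 = -216" "p $ 2 = 216" "p $ 3 = 216" "p $ 4 = 0" "p $ 5 = 0" "p $ 6 = -216"
        "p' $ 1 = 0" "p' $ 2 = 0" "p' $ 3 = 216" "p' $ 4 = 216" "p' $ 5 = -216" "p' $ 6 = -216"
        unfolding p_defs line_dir_def line_dir'_def q by (simp_all add: e_defs vector_6)
      have pol: "polar x p = - 233280 - 15552 * z" "polar' x p' = - 93312" "polar x p' = 93312"
        "polar' x p = - 326592 - 46656 * z"
        unfolding polar_def polar'_def q unfolding B_defs form_defs dir xs by (simp_all add:
            algebra_simps)
      have tr: "transversal x = 5804752896 * (9 + z)"
        unfolding transversal_def p_defs[symmetric] pol by (simp add: algebra_simps)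
      have "(9 + z) * (9 - z) = 36" using root\<^sub>z by algebra
      then have "9 + z \<noteq> 0" by auto
      then show ?thesis unfolding q(2) c\<^sub>0 tr mult_eq_0_iff by simp
    next
      case 2
      then have root\<^sub>z: "z\<^sup>2 + 243 = 0" by simp
      have q: "B\<^sub>1 x x = 216" "B\<^sub>2 x x = 72"
        unfolding B_defs form_defs xs by (use root\<^sub>z in algebra | simp)+
      have c\<^sub>0: "c\<^sub>0 x = 9 + z"
        unfolding c_defs xs by simp
      define p p' where p_defs: "p = line_dir x" "p' = line_dir' x"
      have dir: "p $ 1 = 360" "p $ 2 = -72" "p $ 3 = -72" "p $ 4 = -288" "p $ 5 = -288"
        "p $ 6 = 360"
        "p' $ 1 = 288" "p' $ 2 = 288" "p' $ 3 = -360" "p' $ 4 = -360" "p' $ 5 = 72" "p' $ 6 = 72"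
        unfolding p_defs line_dir_def line_dir'_def q by (simp_all add: e_defs vector_6)
      have pol: "polar x p = 699840 + 46656 * z" "polar' x p' = 2519424" "polar x p' = 839808"
        "polar' x p = 419904 - 46656 * z"
        unfolding polar_def polar'_def q unfolding B_defs form_defs dir xs by (simp_all add:
            algebra_simps)
      have tr: "transversal x = 156728328192 * (9 + z)"
        unfolding transversal_def p_defs[symmetric] pol by (simp add: algebra_simps)
      have "(9 + z) * (9 - z) = 324" using root\<^sub>z by algebra
      then have "9 + z \<noteq> 0" by auto
      then show ?thesis unfolding q(2) c\<^sub>0 tr mult_eq_0_iff by simp
    qed
  qed (simp_all add: coord_sum_def sum_6 vector_6)
qed

text \<open>The equation is \<open>(N - \<omega> e) (N - \<omega>\<^sup>2 e) = 3 z\<^sub>3 z\<^sub>4 z\<^sub>5 z\<^sub>6\<close>. The hyperplane \<open>c\<^sub>0 = 0\<close> is, on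
  \<open>coord_sum x = 0\<close>, a multiple of \<open>(x\<^sub>1 + x\<^sub>5) + \<omega> (x\<^sub>2 + x\<^sub>3) + \<omega>\<^sup>2 (x\<^sub>4 + x\<^sub>6) = 0\<close>. It cuts
  the quartic in two quadric surfaces, a cone and a smooth one; the latter supplies the lines. The
  vectors \<open>e\<^sub>1, \<dots>, e\<^sub>4\<close> are combinations of four nodes of the quartic on this surface. The test
  line has four points over \<open>\<omega>\<close> because \<open>2 + \<omega>\<close> and \<open>1 - \<omega>\<close> are square roots of \<open>- 3 \<omega>\<^sup>2\<close> and \<open>- 3
  \<omega>\<close>.\<close>
lemma quartic_one_sixth_rational:
  fixes \<omega> :: "'k::{alg_closed_field, field_char_0}"
  assumes \<omega>: "\<omega>\<^sup>2 + \<omega> + 1 = 0"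
  shows "rational_threefold (quartic (1/6 :: 'k))"
proof -
  define B\<^sub>1 where "B\<^sub>1 = (\<lambda>(x :: 'k ^ 6) (y :: 'k ^ 6). N\<^sub>1\<^sub>2 x y
      - \<omega> * e\<^sub>3\<^sub>6 x y)"
  define B\<^sub>2 where "B\<^sub>2 = (\<lambda>(x :: 'k ^ 6) (y :: 'k ^ 6). z\<^sub>1\<^sub>2 3 x
      * z\<^sub>1\<^sub>2 4 y)"
  define B\<^sub>3 where "B\<^sub>3 = (\<lambda>(x :: 'k ^ 6) (y :: 'k ^ 6). 3 *
      (z\<^sub>1\<^sub>2 5 x * z\<^sub>1\<^sub>2 6 y))"
  define B\<^sub>4 where "B\<^sub>4 = (\<lambda>(x :: 'k ^ 6) (y :: 'k ^ 6). N\<^sub>1\<^sub>2 x y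
      - \<omega>\<^sup>2 * e\<^sub>3\<^sub>6 x y)"
  define c\<^sub>0 where "c\<^sub>0 = (\<lambda>x :: 'k ^ 6. \<omega> * x $ 2 + \<omega> * x $ 3 -
      x $ 4 - x $ 6)"
  define c\<^sub>1 where "c\<^sub>1 = (\<lambda>x :: 'k ^ 6. ((2 + \<omega>) * x $ 1 + (- 4 - 2 *
      \<omega>) * x $ 2 - 3 * x $ 3 + 3 * x $ 4 + (2 + \<omega>) * x $ 6) / 6)"
  define c\<^sub>2 where "c\<^sub>2 = (\<lambda>x :: 'k ^ 6. ((- 2 - \<omega>) * x $ 2 + (- 3 -
      \<omega>) * x $ 3 + (1 - \<omega>) * x $ 4 + \<omega> * x $ 5) / 6)"
  define c\<^sub>3 where "c\<^sub>3 = (\<lambda>x :: 'k ^ 6. (- x $ 1 - \<omega> * x $ 2 + 2 *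
      \<omega> * x $ 4 + \<omega> * x $ 5 - x $ 6) / 6)"
  define c\<^sub>4 where "c\<^sub>4 = (\<lambda>x :: 'k ^ 6. ((- 1 + 4 * \<omega>) * x $ 1 + (- 2
      - \<omega>) * x $ 2 + 6 * \<omega> * x $ 4 + (- 2 + 5 * \<omega>) * x $ 5 + (- 1 + 4 *
      \<omega>) * x $ 6) / 18)"
  define e\<^sub>0 :: "'k ^ 6" where "e\<^sub>0 = vector [1, 0, 0, 0, 0, - 1]"
  define e\<^sub>1 :: "'k ^ 6" where "e\<^sub>1 = vector [1, \<omega>, - 1 - \<omega>, - 1 -
      \<omega>, \<omega>, 1]"
  \<comment> \<open>In terms of \<open>p = (1, 1, -1, 1, -1, -1)\<close>, \<open>q = (1, 1, -1, -1, -1, 1)\<close> and \<open>r = (1, \<omega>, 1, \<omega>,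
      \<omega>\<^sup>2, \<omega>\<^sup>2)\<close> these are \<open>(2 + \<omega>) p - e\<^sub>1\<close>, \<open>(1 + 2 \<omega>) q - r\<close> and \<open>3 r\<close>; here \<open>e\<^sub>1\<close>, \<open>p\<close>, \<open>q\<close>
      and \<open>r\<close> are nodes.\<close>
  define e\<^sub>2 :: "'k ^ 6" where "e\<^sub>2 = vector [1 + \<omega>, 2, - 1, 3 + 2 * \<omega>,
      - 2 - 2 * \<omega>, - 3 - \<omega>]"
  define e\<^sub>3 :: "'k ^ 6" where "e\<^sub>3 = vector [2 * \<omega>, 1 + \<omega>, - 2 - 2 *
      \<omega>, - 1 - 3 * \<omega>, - \<omega>, 2 + 3 * \<omega>]"
  define e\<^sub>4 :: "'k ^ 6" where "e\<^sub>4 = vector [3, 3 * \<omega>, 3, 3 * \<omega>, - 3 -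
      3 * \<omega>, - 3 - 3 * \<omega>]"
  note B_defs = B\<^sub>1_def B\<^sub>2_def B\<^sub>3_def B\<^sub>4_def
  note c_defs = c\<^sub>0_def c\<^sub>1_def c\<^sub>2_def c\<^sub>3_def c\<^sub>4_def
  note e_defs = e\<^sub>0_def e\<^sub>1_def e\<^sub>2_def e\<^sub>3_def e\<^sub>4_def
  interpret line_pencil B\<^sub>1 B\<^sub>2 B\<^sub>3 B\<^sub>4 c\<^sub>0 c\<^sub>1 c\<^sub>2
      c\<^sub>3 c\<^sub>4 e\<^sub>0 e\<^sub>1 e\<^sub>2 e\<^sub>3 e\<^sub>4 1 "4/3" "1/6"
  proof unfold_locales
    show "bilinear_form B\<^sub>1" "bilinear_form B\<^sub>2" "bilinear_form B\<^sub>3"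
        "bilinear_form B\<^sub>4"
      unfolding B_defs by (intro form_intros)+
    show "linear_form c\<^sub>0" "linear_form c\<^sub>1" "linear_form c\<^sub>2" "linear_form
        c\<^sub>3" "linear_form c\<^sub>4"
      unfolding c_defs by (intro form_intros)+
    show "x = c\<^sub>0 x *s e\<^sub>0 + c\<^sub>1 x *s e\<^sub>1 + c\<^sub>2 x *s e\<^sub>2 +
        c\<^sub>3 x *s e\<^sub>3 + c\<^sub>4 x *s e\<^sub>4"
      if "coord_sum x = 0" for x
      unfolding vec_eq_iff forall_6 c_defs e_defs vector_add_component vector_smult_component
        vector_6 last_coord[OF that] z\<^sub>1\<^sub>2_def
      by (intro conjI; (simp add: field_simps)?; (use \<omega> in algebra)?)
    show "c\<^sub>0 x = r\<^sub>0 \<and> c\<^sub>1 x = r\<^sub>1 \<and> c\<^sub>2 x = r\<^sub>2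
        \<and> c\<^sub>3 x = r\<^sub>3 \<and> c\<^sub>4 x = r\<^sub>4"
      if x: "x = r\<^sub>0 *s e\<^sub>0 + r\<^sub>1 *s e\<^sub>1 + r\<^sub>2 *s e\<^sub>2 +
          r\<^sub>3 *s e\<^sub>3 + r\<^sub>4 *s e\<^sub>4"
      for x r\<^sub>0 r\<^sub>1 r\<^sub>2 r\<^sub>3 r\<^sub>4
      unfolding x c_defs e_defs z\<^sub>1\<^sub>2_def vector_add_component vector_smult_component
          vector_6
      by (intro conjI; (simp add: field_simps)?; (use \<omega> in algebra)?)
    show "y\<^sub>1 * B\<^sub>1 x x = y\<^sub>2 * B\<^sub>2 x x \<and> y\<^sub>1 * B\<^sub>3 x x =
        y\<^sub>2 * B\<^sub>4 x x"
      if x: "x = m *s (y\<^sub>2 *s e\<^sub>1 + y\<^sub>1 *s e\<^sub>2) + l *s ((1 * y\<^sub>2) *s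
          e\<^sub>3 + y\<^sub>1 *s e\<^sub>4)"
      for x m l y\<^sub>1 y\<^sub>2
      unfolding x B_defs e_defs form_defs vector_add_component vector_smult_component vector_6
      by (intro conjI; use \<omega> in algebra)
    show "quartic_form (1/6) x = 4/3 * (B\<^sub>1 x x * B\<^sub>4 x x - B\<^sub>2 x x * B\<^sub>3
        x x)"
      if x: "coord_sum x = 0" for x
      proof -
        have "6 * quartic_form (1/6) x = 8 * (B\<^sub>1 x x * B\<^sub>4 x x - B\<^sub>2 x x *
            B\<^sub>3 x x)"
          unfolding quartic_form_NE_fraction[OF x zero_neq_numeral[symmetric]] B_defs using
              \<omega> by algebra
        from eq_fraction_times[OF this] show ?thesis by simp
      qed
  qed (simp_all add: e_defs coord_sum_def sum_6 vector_6)
  show ?thesis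
  proof (rule rational[where x\<^sub>0 = "vector [1, - 2, 0, 0, 1, 0]" and w = "vector [0, 0, 0,
      1, 0, - 1]"])
    show "4/3 \<noteq> (0 :: 'k)"
      by simp
    show "quartic_form (1/6) (vector [0, 0, 0, 1, 0, - 1] :: 'k ^ 6) \<noteq> 0"
      unfolding quartic_form_def sum_6 vector_6 by simp
    fix z and x :: "'k ^ 6"
    assume x: "x = vector [1, - 2, 0, 0, 1, 0] + z *s vector [0, 0, 0, 1, 0, - 1]" and root:
        "quartic_form (1/6) x = 0"
    have xs: "x $ 1 = 1" "x $ 2 = - 2" "x $ 3 = 0" "x $ 4 = z" "x $ 5 = 1" "x $ 6 = - z"
      unfolding x by (simp_all add: vector_6)
    have "6 * quartic_form (1/6) x = 8 * ((z - (2 + \<omega>)) * (z - (- 2 - \<omega>)) * (z - (1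
        - \<omega>)) * (z - (- 1 + \<omega>)))"
      unfolding quartic_form_fraction[OF zero_neq_numeral[symmetric]] xs
      using \<omega> by (simp only: power_zero_numeral power_one) algebra
    then consider "z = 2 + \<omega>" | "z = - 2 - \<omega>" | "z = 1 - \<omega>" | "z = - 1 +
        \<omega>"
      using root by auto
    then show "c\<^sub>0 x \<noteq> 0 \<and> B\<^sub>2 x x \<noteq> 0 \<and> transversal x
        \<noteq> 0"
    proof cases
      case 1
      have at_root: "x $ 1 = 1" "x $ 2 = - 2" "x $ 3 = 0" "x $ 4 = 2 + \<omega>" "x $ 5 = 1"
        "x $ 6 = - 2 - \<omega>"
        unfolding xs 1 by (rule refl | use \<omega> in algebra | algebra | simp)+
      have q: "B\<^sub>1 x x = 0" "B\<^sub>2 x x = - 1 - \<omega>"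
        unfolding B_defs form_defs at_root by (rule refl | use \<omega> in algebra | algebra |
            simp)+
      have c: "c\<^sub>0 x = - 2 * \<omega>"
        unfolding c_defs form_defs at_root by ((simp add: field_simps)?; (use \<omega> in algebra)?)
      have tr: "transversal x = - 81 + 162 * \<omega>"
        unfolding transversal_def polar_def polar'_def line_dir_def line_dir'_def q
        unfolding B_defs e_defs form_defs vector_add_component vector_smult_component vector_6
            at_root
        using \<omega> by algebra
      have "B\<^sub>2 x x * \<omega> = 1" unfolding q using \<omega> by algebra
      then have "B\<^sub>2 x x \<noteq> 0" by auto
      moreover have "c\<^sub>0 x * (1 + \<omega>) = 2" unfolding c using \<omega> by algebra
      then have "c\<^sub>0 x \<noteq> 0" by auto
      moreover have "transversal x * (- 3 - 2 * \<omega>) = 567" unfolding tr using \<omega> by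
          algebra
      then have "transversal x \<noteq> 0" by auto
      ultimately show ?thesis by simp
    next
      case 2
      have at_root: "x $ 1 = 1" "x $ 2 = - 2" "x $ 3 = 0" "x $ 4 = - 2 - \<omega>" "x $ 5 = 1"
        "x $ 6 = 2 + \<omega>"
        unfolding xs 2 by (rule refl | use \<omega> in algebra | algebra | simp)+
      have q: "B\<^sub>1 x x = 0" "B\<^sub>2 x x = 3 + \<omega>"
        unfolding B_defs form_defs at_root by (rule refl | use \<omega> in algebra | algebra |
            simp)+
      have c: "c\<^sub>0 x = - 2 * \<omega>"
        unfolding c_defs form_defs at_root by ((simp add: field_simps)?; (use \<omega> in algebra)?)
      have tr: "transversal x = - 621 - 2538 * \<omega>"
        unfolding transversal_def polar_def polar'_def line_dir_def line_dir'_def q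
        unfolding B_defs e_defs form_defs vector_add_component vector_smult_component vector_6
            at_root
        using \<omega> by algebra
      have "B\<^sub>2 x x * (2 - \<omega>) = 7" unfolding q using \<omega> by algebra
      then have "B\<^sub>2 x x \<noteq> 0" by auto
      moreover have "c\<^sub>0 x * (1 + \<omega>) = 2" unfolding c using \<omega> by algebra
      then have "c\<^sub>0 x \<noteq> 0" by auto
      moreover have "transversal x * (71 + 94 * \<omega>) = 194481" unfolding tr using \<omega> by
          algebra
      then have "transversal x \<noteq> 0" by auto
      ultimately show ?thesis by simp
    next
      case 3
      have at_root: "x $ 1 = 1" "x $ 2 = - 2" "x $ 3 = 0" "x $ 4 = 1 - \<omega>" "x $ 5 = 1"
        "x $ 6 = - 1 + \<omega>"
        unfolding xs 3 by (rule refl | use \<omega> in algebra | algebra | simp)+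
      have q: "B\<^sub>1 x x = 6 + 3 * \<omega>" "B\<^sub>2 x x = \<omega>"
        unfolding B_defs form_defs at_root by (rule refl | use \<omega> in algebra | algebra |
            simp)+
      have c: "c\<^sub>0 x = - 2 * \<omega>"
        unfolding c_defs form_defs at_root by ((simp add: field_simps)?; (use \<omega> in algebra)?)
      have tr: "transversal x = 5616 + 4752 * \<omega>"
        unfolding transversal_def polar_def polar'_def line_dir_def line_dir'_def q
        unfolding B_defs e_defs form_defs vector_add_component vector_smult_component vector_6
            at_root
        using \<omega> by algebra
      have "B\<^sub>2 x x * (- 1 - \<omega>) = 1" unfolding q using \<omega> by algebra
      then have "B\<^sub>2 x x \<noteq> 0" by auto
      moreover have "c\<^sub>0 x * (1 + \<omega>) = 2" unfolding c using \<omega> by algebra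
      then have "c\<^sub>0 x \<noteq> 0" by auto
      moreover have "transversal x * (2 - 11 * \<omega>) = 63504" unfolding tr using \<omega> by
          algebra
      then have "transversal x \<noteq> 0" by auto
      ultimately show ?thesis by simp
    next
      case 4
      have at_root: "x $ 1 = 1" "x $ 2 = - 2" "x $ 3 = 0" "x $ 4 = - 1 + \<omega>" "x $ 5 = 1"
        "x $ 6 = 1 - \<omega>"
        unfolding xs 4 by (rule refl | use \<omega> in algebra | algebra | simp)+
      have q: "B\<^sub>1 x x = 6 + 3 * \<omega>" "B\<^sub>2 x x = 2 - \<omega>"
        unfolding B_defs form_defs at_root by (rule refl | use \<omega> in algebra | algebra |
            simp)+
      have c: "c\<^sub>0 x = - 2 * \<omega>"
        unfolding c_defs form_defs at_root by ((simp add: field_simps)?; (use \<omega> in algebra)?)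
      have tr: "transversal x = - 27216 - 9072 * \<omega>"
        unfolding transversal_def polar_def polar'_def line_dir_def line_dir'_def q
        unfolding B_defs e_defs form_defs vector_add_component vector_smult_component vector_6
            at_root
        using \<omega> by algebra
      have "B\<^sub>2 x x * (3 + \<omega>) = 7" unfolding q using \<omega> by algebra
      then have "B\<^sub>2 x x \<noteq> 0" by auto
      moreover have "c\<^sub>0 x * (1 + \<omega>) = 2" unfolding c using \<omega> by algebra
      then have "c\<^sub>0 x \<noteq> 0" by auto
      moreover have "transversal x * (- 2 + \<omega>) = 63504" unfolding tr using \<omega> by
          algebra
      then have "transversal x \<noteq> 0" by auto
      ultimately show ?thesis by simp
    qed
  qed (simp_all add: coord_sum_def sum_6 vector_6)
qed

text \<open>The lines are one ruling of a smooth quadric surface in the hyperplane \<open>x\<^sub>1 + x\<^sub>2 + x\<^sub>3 =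
  0\<close>; the coefficients of the \<open>\<sigma>\<^sub>i\<close> are the combinations for which the lines lie in the fibres. On
  the test line \<open>x\<^sub>1 = x\<^sub>4 = x\<^sub>6 = 0\<close> the sum of the fourth powers is half the square of the sum
  of the squares; so it meets the quartic only in the two points where the sum of the squares
  vanishes, whose other coordinates are the three cube roots of unity.\<close>
lemma quartic_seven_tenths_rational:
  fixes \<omega> \<phi> :: "'k::{alg_closed_field, field_char_0}"
  assumes \<omega>: "\<omega>\<^sup>2 + \<omega> + 1 = 0" and \<phi>: "\<phi>\<^sup>2 - \<phi> - 1
      = 0"
  shows "rational_threefold (quartic (7/10 :: 'k))"
proof -
  define B\<^sub>1 where "B\<^sub>1 = (\<lambda>(x :: 'k ^ 6) (y :: 'k ^ 6). \<sigma>\<^sub>2 x y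
      + (- 1 - \<omega> * \<phi>) * \<sigma>\<^sub>3 x y + (- 1 - \<omega> + \<omega> * \<phi>) *
      \<sigma>\<^sub>4 x y + (1 + \<omega>) * \<sigma>\<^sub>5 x y)"
  define B\<^sub>2 where "B\<^sub>2 = (\<lambda>(x :: 'k ^ 6) (y :: 'k ^ 6). (2 - 2 * \<omega>) *
      \<sigma>\<^sub>1 x y + (- 3 - 2 * \<omega>) * \<sigma>\<^sub>2 x y + (- 1 + \<phi> +
      \<omega> * \<phi>) * \<sigma>\<^sub>3 x y + (\<omega> - \<phi> - \<omega> * \<phi>) *
      \<sigma>\<^sub>4 x y + (2 + 3 * \<omega>) * \<sigma>\<^sub>5 x y)"
  define B\<^sub>3 where "B\<^sub>3 = (\<lambda>(x :: 'k ^ 6) (y :: 'k ^ 6). \<sigma>\<^sub>1 x y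
      + (\<omega> - \<phi> - \<omega> * \<phi>) * \<sigma>\<^sub>3 x y + (- 1 + \<phi> + \<omega>
      * \<phi>) * \<sigma>\<^sub>4 x y + (- \<omega>) * \<sigma>\<^sub>5 x y)"
  define B\<^sub>4 where "B\<^sub>4 = (\<lambda>(x :: 'k ^ 6) (y :: 'k ^ 6). (- 2 - 3 * \<omega>)
      * \<sigma>\<^sub>1 x y + (- 2 + 2 * \<omega>) * \<sigma>\<^sub>2 x y + (1 - \<phi> -
      \<omega> * \<phi>) * \<sigma>\<^sub>3 x y + (- \<omega> + \<phi> + \<omega> * \<phi>) *
      \<sigma>\<^sub>4 x y + (3 + 2 * \<omega>) * \<sigma>\<^sub>5 x y)"
  define c\<^sub>0 where "c\<^sub>0 = (\<lambda>x :: 'k ^ 6. (x $ 1 + x $ 2 + x $ 3) / 3)"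
  define c\<^sub>1 where "c\<^sub>1 = (\<lambda>x :: 'k ^ 6. (3 * \<phi> - 4) / 15 * (x $ 1 +
      \<omega> * x $ 2 + \<omega>\<^sup>2 * x $ 3))"
  define c\<^sub>2 where "c\<^sub>2 = (\<lambda>x :: 'k ^ 6. (x $ 4 + \<omega> * x $ 5 +
      \<omega>\<^sup>2 * x $ 6) / 3)"
  define c\<^sub>3 where "c\<^sub>3 = (\<lambda>x :: 'k ^ 6. (1 + 3 * \<phi>) / 15 * (x $ 4 +
      \<omega>\<^sup>2 * x $ 5 + \<omega> * x $ 6))"
  define c\<^sub>4 where "c\<^sub>4 = (\<lambda>x :: 'k ^ 6. - (x $ 1 + \<omega>\<^sup>2 * x $ 2 +
      \<omega> * x $ 3) / 3)"
  define e\<^sub>0 :: "'k ^ 6" where "e\<^sub>0 = vector [1, 1, 1, - 1, - 1, - 1]"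
  \<comment> \<open>The scalars on \<open>e\<^sub>1\<close> and \<open>e\<^sub>3\<close> are fixed by the requirement that the lines lie in the fibres;
      their product is \<open>(1 + 3 * \<phi>) * (3 * \<phi> - 4) = 5\<close>.\<close>
  define e\<^sub>1 :: "'k ^ 6" where "e\<^sub>1 = vector [1 + 3 * \<phi>, - 1 - \<omega> - 3 *
      \<phi> - 3 * \<omega> * \<phi>, \<omega> + 3 * \<omega> * \<phi>, 0, 0, 0]"
  define e\<^sub>2 :: "'k ^ 6" where "e\<^sub>2 = vector [0, 0, 0, 1, - 1 - \<omega>, \<omega>]"
  define e\<^sub>3 :: "'k ^ 6" where "e\<^sub>3 = vector [0, 0, 0, - 4 + 3 * \<phi>, - 4 *
      \<omega> + 3 * \<omega> * \<phi>, 4 + 4 * \<omega> - 3 * \<phi> - 3 * \<omega> * \<phi>]"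
  define e\<^sub>4 :: "'k ^ 6" where "e\<^sub>4 = vector [- 1, - \<omega>, 1 + \<omega>, 0, 0, 0]"
  note B_defs = B\<^sub>1_def B\<^sub>2_def B\<^sub>3_def B\<^sub>4_def
  note c_defs = c\<^sub>0_def c\<^sub>1_def c\<^sub>2_def c\<^sub>3_def c\<^sub>4_def
  note e_defs = e\<^sub>0_def e\<^sub>1_def e\<^sub>2_def e\<^sub>3_def e\<^sub>4_def
  interpret line_pencil B\<^sub>1 B\<^sub>2 B\<^sub>3 B\<^sub>4 c\<^sub>0 c\<^sub>1 c\<^sub>2
      c\<^sub>3 c\<^sub>4 e\<^sub>0 e\<^sub>1 e\<^sub>2 e\<^sub>3 e\<^sub>4 1 "(4 + 2 * \<omega>)
      / 15" "7/10"
  proof unfold_locales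
    show "bilinear_form B\<^sub>1" "bilinear_form B\<^sub>2" "bilinear_form B\<^sub>3"
        "bilinear_form B\<^sub>4"
      unfolding B_defs by (intro form_intros)+
    show "linear_form c\<^sub>0" "linear_form c\<^sub>1" "linear_form c\<^sub>2" "linear_form
        c\<^sub>3" "linear_form c\<^sub>4"
      unfolding c_defs by (intro form_intros)+
    show "x = c\<^sub>0 x *s e\<^sub>0 + c\<^sub>1 x *s e\<^sub>1 + c\<^sub>2 x *s e\<^sub>2 +
        c\<^sub>3 x *s e\<^sub>3 + c\<^sub>4 x *s e\<^sub>4"
      if "coord_sum x = 0" for x
      unfolding vec_eq_iff forall_6 c_defs e_defs vector_add_component vector_smult_component
        vector_6 last_coord[OF that] z\<^sub>1\<^sub>2_def
      by (intro conjI; (simp add: field_simps)?; (use \<omega> \<phi> in algebra)?)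
    show "c\<^sub>0 x = r\<^sub>0 \<and> c\<^sub>1 x = r\<^sub>1 \<and> c\<^sub>2 x = r\<^sub>2
        \<and> c\<^sub>3 x = r\<^sub>3 \<and> c\<^sub>4 x = r\<^sub>4"
      if x: "x = r\<^sub>0 *s e\<^sub>0 + r\<^sub>1 *s e\<^sub>1 + r\<^sub>2 *s e\<^sub>2 +
          r\<^sub>3 *s e\<^sub>3 + r\<^sub>4 *s e\<^sub>4"
      for x r\<^sub>0 r\<^sub>1 r\<^sub>2 r\<^sub>3 r\<^sub>4
      unfolding x c_defs e_defs z\<^sub>1\<^sub>2_def vector_add_component vector_smult_component
          vector_6
      by (intro conjI; (simp add: field_simps)?; (use \<omega> \<phi> in algebra)?)
    show "y\<^sub>1 * B\<^sub>1 x x = y\<^sub>2 * B\<^sub>2 x x \<and> y\<^sub>1 * B\<^sub>3 x x =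
        y\<^sub>2 * B\<^sub>4 x x"
      if x: "x = m *s (y\<^sub>2 *s e\<^sub>1 + y\<^sub>1 *s e\<^sub>2) + l *s ((1 * y\<^sub>2) *s
          e\<^sub>3 + y\<^sub>1 *s e\<^sub>4)"
      for x m l y\<^sub>1 y\<^sub>2
      unfolding x B_defs e_defs form_defs pair_form_def vector_add_component
          vector_smult_component vector_6
      by (intro conjI; use \<omega> \<phi> in algebra)
    show "quartic_form (7/10) x = ((4 + 2 * \<omega>) / 15) * (B\<^sub>1 x x * B\<^sub>4 x x -
        B\<^sub>2 x x * B\<^sub>3 x x)"
      if x: "coord_sum x = 0" for x
      proof -
        have "10 * (15 * quartic_form (7/10) x) = 10 * ((4 + 2 * \<omega>) * (B\<^sub>1 x x *
            B\<^sub>4 x x - B\<^sub>2 x x * B\<^sub>3 x x))"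
          unfolding mult.left_commute[of 10 15] quartic_form_total[OF x] B_defs using \<omega>
              \<phi> by algebra
        then have "15 * quartic_form (7/10) x = (4 + 2 * \<omega>) * (B\<^sub>1 x x * B\<^sub>4 x
            x - B\<^sub>2 x x * B\<^sub>3 x x)"
          by simp
        from eq_fraction_times[OF this] show ?thesis by simp
      qed
  qed (simp_all add: e_defs coord_sum_def sum_6 vector_6)
  show ?thesis
  proof (rule rational[where x\<^sub>0 = "vector [0, 1, 0, 0, - 1, 0]" and w = "vector [0, 0, 1,
      0, - 1, 0]"])
    show "(4 + 2 * \<omega>) / 15 \<noteq> (0 :: 'k)"
      proof -
      have "(4 + 2 * \<omega>) * (1 - \<omega>) = 6" using \<omega> by algebra
      then show ?thesis by auto
    qed
    show "quartic_form (7/10) (vector [0, 0, 1, 0, - 1, 0] :: 'k ^ 6) \<noteq> 0"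
      unfolding quartic_form_def sum_6 vector_6 by simp
    fix z and x :: "'k ^ 6"
    assume x: "x = vector [0, 1, 0, 0, - 1, 0] + z *s vector [0, 0, 1, 0, - 1, 0]" and root:
        "quartic_form (7/10) x = 0"
    have xs: "x $ 1 = 0" "x $ 2 = 1" "x $ 3 = z" "x $ 4 = 0" "x $ 5 = - 1 - z" "x $ 6 = 0"
      unfolding x by (simp_all add: vector_6)
    have "10 * quartic_form (7/10) x = - 8 * ((z - \<omega>)\<^sup>2 * (z - (- 1 -
        \<omega>))\<^sup>2)"
      unfolding quartic_form_fraction[OF zero_neq_numeral[symmetric]] xs
      using \<omega> by (simp only: power_zero_numeral power_one) algebra
    then consider "z = \<omega>" | "z = - 1 - \<omega>"
      using root by auto
    then show "c\<^sub>0 x \<noteq> 0 \<and> B\<^sub>2 x x \<noteq> 0 \<and> transversal x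
        \<noteq> 0"
    proof cases
      case 1
      have at_root: "x $ 1 = 0" "x $ 2 = 1" "x $ 3 = \<omega>" "x $ 4 = 0"
        "x $ 5 = - 1 - \<omega>" "x $ 6 = 0"
        unfolding xs 1 by (rule refl | use \<omega> \<phi> in algebra | algebra | simp)+
      have q: "B\<^sub>1 x x = - 3 - \<omega> - \<omega> * \<phi>" "B\<^sub>2 x x = - 3 + 2 *
          \<omega> + \<phi> + \<omega> * \<phi>"
        unfolding B_defs form_defs pair_form_def at_root by (rule refl | use \<omega> \<phi> in
            algebra | algebra | simp)+
      have c: "c\<^sub>0 x = (1 + \<omega>) / 3"
        unfolding c_defs form_defs pair_form_def at_root by ((simp add: field_simps)?; (use
            \<omega> \<phi> in algebra)?)
      have tr: "transversal x = - 22500 + 30600 * \<omega> + 20700 * \<phi> - 15300 * \<omega> *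
          \<phi>"
        unfolding transversal_def polar_def polar'_def line_dir_def line_dir'_def q
        unfolding B_defs e_defs form_defs pair_form_def vector_add_component
            vector_smult_component vector_6 at_root
        using \<omega> \<phi> by algebra
      have "B\<^sub>2 x x * (- 5 - 2 * \<omega> - \<omega> * \<phi>) = 20" unfolding q using
          \<omega> \<phi> by algebra
      then have "B\<^sub>2 x x \<noteq> 0" by auto
      moreover have "c\<^sub>0 x * (- 3 * \<omega>) = 1" unfolding c using \<omega> \<phi> by
          algebra
      then have "c\<^sub>0 x \<noteq> 0" by auto
      moreover have "transversal x * (2 - 17 * \<omega> + 23 * \<phi> - 17 * \<omega> * \<phi>) =
          691200" unfolding tr using \<omega> \<phi> by algebra
      then have "transversal x \<noteq> 0" by auto
      ultimately show ?thesis by simp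
    next
      case 2
      have at_root: "x $ 1 = 0" "x $ 2 = 1" "x $ 3 = - 1 - \<omega>" "x $ 4 = 0"
        "x $ 5 = \<omega>" "x $ 6 = 0"
        unfolding xs 2 by (rule refl | use \<omega> \<phi> in algebra | algebra | simp)+
      have q: "B\<^sub>1 x x = - 1 - \<omega> * \<phi>" "B\<^sub>2 x x = 2 - 3 * \<omega> + \<phi>
          + \<omega> * \<phi>"
        unfolding B_defs form_defs pair_form_def at_root by (rule refl | use \<omega> \<phi> in
            algebra | algebra | simp)+
      have c: "c\<^sub>0 x = (- \<omega>) / 3"
        unfolding c_defs form_defs pair_form_def at_root by ((simp add: field_simps)?; (use
            \<omega> \<phi> in algebra)?)
      have tr: "transversal x = 12600 + 900 * \<omega> - 6300 * \<phi> + 900 * \<omega> * \<phi>"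
        unfolding transversal_def polar_def polar'_def line_dir_def line_dir'_def q
        unfolding B_defs e_defs form_defs pair_form_def vector_add_component
            vector_smult_component vector_6 at_root
        using \<omega> \<phi> by algebra
      have "B\<^sub>2 x x * (5 + 3 * \<omega> - \<omega> * \<phi>) = 20" unfolding q using
          \<omega> \<phi> by algebra
      then have "B\<^sub>2 x x \<noteq> 0" by auto
      moreover have "c\<^sub>0 x * (3 + 3 * \<omega>) = 1" unfolding c using \<omega> \<phi> by
          algebra
      then have "c\<^sub>0 x \<noteq> 0" by auto
      moreover have "transversal x * (2 - 5 * \<omega> - \<phi> - 8 * \<omega> * \<phi>) = 43200"
          unfolding tr using \<omega> \<phi> by algebra
      then have "transversal x \<noteq> 0" by auto
      ultimately show ?thesis by simp
    qed
  qed (simp_all add: coord_sum_def sum_6 vector_6)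
qed

theorem theorem4p6:
  shows "rational_threefold (quartic (1/2 :: 'k :: {alg_closed_field, field_char_0})) \<and>
    rational_threefold (quartic (1/4 :: 'k)) \<and>
    rational_threefold (quartic (1/6 :: 'k)) \<and>
    rational_threefold (quartic (7/10 :: 'k))"
proof -
  obtain \<omega> :: 'k where \<omega>: "\<omega>\<^sup>2 + \<omega> + 1 = 0"
    using cube_root_of_unity_exists by blast
  obtain \<phi> :: 'k where \<phi>: "\<phi>\<^sup>2 - \<phi> - 1 = 0"
    using golden_ratio_exists by blast
  show ?thesis
    using burkhardt_quartic_rational[OF \<omega>] igusa_quartic_rational
      quartic_one_sixth_rational[OF \<omega>] quartic_seven_tenths_rational[OF \<omega> \<phi>]
    by blast
qed

end
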